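(* Let $f:\mathcal{P}_2(H)\to U$ be such that its lift $\hat f:L^2(\Omega,H)\to U$, $\hat f(X)=f(\mathcal{L}(X))$, is $\Lambda$-continuously Fréchet differentiable. Then for every $\mu\in\mathcal{P}_2(H)$ there exists a Borel measurable map $\frac{dm_\mu}{d\mu}:H\to L(H,U)$ such that for every $X\in L^2(\Omega,H)$ with $\mathcal{L}(X)=\mu$: (i) $\frac{dm_\mu}{d\mu}(X)\in L^2(\Omega,L(H,U))$; (ii) for every $Y\in L^2(\Omega,H)$ one has $\frac{dm_\mu}{d\mu}(X)Y\in L^1(\Omega,U)$ and $$D\hat f(X)Y=\int Y\,dm_{D\hat f(X)}=\int \mathbb{E}[Y\mid X]\,dm_{D\hat f(X)}=\mathbb{E}\Big[\tfrac{dm_\mu}{d\mu}(X)Y\Big];$$ (iii) $\mathbb{E}\big[\|\tfrac{dm_\mu}{d\mu}(X)\|^2\big]^{1/2}=|\!|\!|D\hat f(X)|\!|\!|_{2,\mathbb{P}}$; (iv) setting $m_\mu(B):=m_{D\hat f(X)}(\{X\in B\})$ for $B\in\mathcal{B}(H)$, one has for all $B\in\mathcal{B}(H)$ and $u\in H$ $$m_\mu(B)u=\int_H \mathbf{1}_B(x)\,\tfrac{dm_\mu}{d\mu}(x)u\,\mu(dx),$$ i.e. $\frac{dm_\mu}{d\mu}$ is a Radon–Nikodym derivative of the vector measure $m_\mu$ with respect to $\mu$; it is $\mu$-almost everywhere uniquely determined, so its equivalence class in $L^2(H,\mu;L(H,U))$ is uniquely defined.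
   Context: $(\Omega,\mathcal{F},\mathbb{P})$ is a complete atomless probability space, $\Omega$ Polish and $\mathcal{F}$ its Borel $\sigma$-field. $H,U$ are separable real Hilbert spaces; $L(H,U)$ carries the operator norm $\|\cdot\|$. $\mathcal{P}_2(H)$ is the set of Borel probability measures on $H$ with finite second moment; $\mathcal{L}(X)$ denotes the law of $X$. A step function is $Y=\sum_{i=1}^n\mathbf{1}_{A_i}x_i$ with $A_i\in\mathcal{F}$, $x_i\in H$. For a bounded linear $L:L^2(\Omega,H)\to U$ the 2-variation norm is $|\!|\!|L|\!|\!|_{2,\mathbb{P}}:=\sup\{\sum_{i=1}^n\|L(\mathbf{1}_{A_i}x_i)\|_U:\ Y=\sum_{i=1}^n\mathbf{1}_{A_i}x_i \text{ step function},\ A_i \text{ pairwise disjoint},\ \mathbb{E}\|Y\|_H^2\le 1\}$, and $\Lambda_2^{\mathbb{P}}(H,U)$ is the (Banach) space of such $L$ with $|\!|\!|L|\!|\!|_{2,\mathbb{P}}<\infty$. A map $\hat f:L^2(\Omega,H)\to U$ is called $\Lambda$-continuously Fréchet differentiable if it is Fréchet differentiable, $D\hat f(X)\in\Lambda_2^{\mathbb{P}}(H,U)$ for all $X$, and $X\mapsto D\hat f(X)$ is continuous from $L^2(\Omega,H)$ into $(\Lambda_2^{\mathbb{P}}(H,U),|\!|\!|\cdot|\!|\!|_{2,\mathbb{P}})$. For $L\in\Lambda_2^{\mathbb{P}}(H,U)$, $m_L:\mathcal{F}\to L(H,U)$, $m_L(A)u:=L(u\mathbf{1}_A)$, is a countably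 additive vector measure; its integral is defined on step functions by $\int\sum_i\mathbf{1}_{A_i}x_i\,dm_L:=\sum_i m_L(A_i)x_i$, and for $Y\in L^2(\Omega,H)$ by $\int Y\,dm_L:=\lim_n\int Y_n\,dm_L$ for any sequence of step functions $Y_n\to Y$ in $L^2(\Omega,H)$ and $\mathbb{P}$-a.s. (the limit exists and does not depend on the sequence). *)

theory Defs
  imports "HOL-Probability.Probability"
begin

definition atomless :: "'o measure \<Rightarrow> bool" where
  "atomless M \<longleftrightarrow> (\<forall>A\<in>sets M. 0 < measure M A \<longrightarrow>
      (\<exists>B\<in>sets M. B \<subseteq> A \<and> 0 < measure M B \<and> measure M B < measure M A))"

text \<open>Representatives of L2(Omega,H): measurable, square integrable.\<close>
definition L2 :: "'o measure \<Rightarrow> ('o \<Rightarrow> 'h::{banach,second_countable_topology}) set" where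
  "L2 M = {X. X \<in> borel_measurable M \<and> integrable M (\<lambda>\<omega>. (norm (X \<omega>))\<^sup>2)}"

definition L2norm :: "'o measure \<Rightarrow> ('o \<Rightarrow> 'h::real_normed_vector) \<Rightarrow> real" where
  "L2norm M X = sqrt (\<integral>\<omega>. (norm (X \<omega>))\<^sup>2 \<partial>M)"

definition P2 :: "'h::{banach,second_countable_topology} measure set" where
  "P2 = {\<mu>. sets \<mu> = sets borel \<and> prob_space \<mu> \<and> integrable \<mu> (\<lambda>x. (norm x)\<^sup>2)}"

definition bounded_linear_L2 :: "'o measure \<Rightarrow> (('o \<Rightarrow> 'h::{banach,second_countable_topology}) \<Rightarrow> 'u::real_normed_vector) \<Rightarrow> bool" where
  "bounded_linear_L2 M L \<longleftrightarrow>
     (\<forall>Y\<in>L2 M. \<forall>Z\<in>L2 M. \<forall>a b::real. L (\<lambda>\<omega>. a *\<^sub>R Y \<omega> + b *\<^sub>R Z \<omega>) = a *\<^sub>R L Y + b *\<^sub>R L Z)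
     \<and> (\<exists>C. \<forall>Y\<in>L2 M. norm (L Y) \<le> C * L2norm M Y)"

definition frechet_L2 :: "'o measure \<Rightarrow> (('o \<Rightarrow> 'h::{banach,second_countable_topology}) \<Rightarrow> 'u::real_normed_vector)
    \<Rightarrow> ('o \<Rightarrow> 'h) \<Rightarrow> (('o \<Rightarrow> 'h) \<Rightarrow> 'u) \<Rightarrow> bool" where
  "frechet_L2 M F X L \<longleftrightarrow> bounded_linear_L2 M L \<and>
     (\<forall>e>0. \<exists>d>0. \<forall>Y\<in>L2 M. L2norm M Y < d \<longrightarrow>
        norm (F (\<lambda>\<omega>. X \<omega> + Y \<omega>) - F X - L Y) \<le> e * L2norm M Y)"

definition tnorm :: "'o measure \<Rightarrow> (('o \<Rightarrow> 'h::real_normed_vector) \<Rightarrow> 'u::real_normed_vector) \<Rightarrow> ereal" where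
  "tnorm M L = (SUP (n, A, x) \<in> {(n::nat, A::nat \<Rightarrow> 'o set, x::nat \<Rightarrow> 'h).
        (\<forall>i<n. A i \<in> sets M) \<and> disjoint_family_on A {..<n} \<and>
        (\<integral>\<omega>. (norm (\<Sum>i<n. indicator (A i) \<omega> *\<^sub>R x i))\<^sup>2 \<partial>M) \<le> 1}.
      ereal (\<Sum>i<n. norm (L (\<lambda>\<omega>. indicator (A i) \<omega> *\<^sub>R x i))))"

definition Lambda_C1 :: "'o measure \<Rightarrow> (('o \<Rightarrow> 'h::{banach,second_countable_topology}) \<Rightarrow> 'u::real_normed_vector)
    \<Rightarrow> (('o \<Rightarrow> 'h) \<Rightarrow> ('o \<Rightarrow> 'h) \<Rightarrow> 'u) \<Rightarrow> bool" where
  "Lambda_C1 M F D \<longleftrightarrow>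
     (\<forall>X\<in>L2 M. frechet_L2 M F X (D X) \<and> tnorm M (D X) < \<infinity>) \<and>
     (\<forall>X\<in>L2 M. \<forall>e>0. \<exists>d>0. \<forall>X'\<in>L2 M. L2norm M (\<lambda>\<omega>. X' \<omega> - X \<omega>) < d \<longrightarrow>
        tnorm M (\<lambda>Y. D X' Y - D X Y) < ereal e)"

text \<open>Integral of Y w.r.t. the vector measure m_L: limit of integrals of step functions
  converging to Y in L2 and almost surely.\<close>
definition vm_integral :: "'o measure \<Rightarrow> (('o \<Rightarrow> 'h::real_normed_vector) \<Rightarrow> 'u::real_normed_vector)
    \<Rightarrow> ('o \<Rightarrow> 'h) \<Rightarrow> 'u" where
  "vm_integral M L Y = (THE v. \<exists>(n::nat \<Rightarrow> nat) (A::nat \<Rightarrow> nat \<Rightarrow> 'o set) (x::nat \<Rightarrow> nat \<Rightarrow> 'h).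
      (\<forall>k. \<forall>i<n k. A k i \<in> sets M) \<and>
      (\<lambda>k. L2norm M (\<lambda>\<omega>. (\<Sum>i<n k. indicator (A k i) \<omega> *\<^sub>R x k i) - Y \<omega>)) \<longlonglongrightarrow> 0 \<and>
      (AE \<omega> in M. (\<lambda>k. \<Sum>i<n k. indicator (A k i) \<omega> *\<^sub>R x k i) \<longlonglongrightarrow> Y \<omega>) \<and>
      (\<lambda>k. \<Sum>i<n k. L (\<lambda>\<omega>. indicator (A k i) \<omega> *\<^sub>R x k i)) \<longlonglongrightarrow> v)"

definition cond_exp_H :: "'o measure \<Rightarrow> ('o \<Rightarrow> 'h::{banach,second_countable_topology})
    \<Rightarrow> ('o \<Rightarrow> 'h) \<Rightarrow> ('o \<Rightarrow> 'h)" where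
  "cond_exp_H M X Y = (SOME Z. Z \<in> borel_measurable (vimage_algebra (space M) X borel) \<and>
      integrable M Z \<and>
      (\<forall>A\<in>sets (vimage_algebra (space M) X borel).
          (\<integral>\<omega>. indicator A \<omega> *\<^sub>R Z \<omega> \<partial>M) = (\<integral>\<omega>. indicator A \<omega> *\<^sub>R Y \<omega> \<partial>M)))"

end

theory Submission
  imports Defs
begin

text \<open>
  Suppose first that \<open>X\<close> takes finitely many values. The lift sees only the law of
  \<open>X + t 1\<^sub>A u\<close>, so for \<open>A \<subseteq> {X = x}\<close> the derivative \<open>D X (1\<^sub>A u)\<close> depends on
  \<open>A\<close> through its probability alone. It is additive and continuous in \<open>A\<close>, and an atomless
  space has subsets of every intermediate probability, so it is proportional to \<open>P A\<close>. Hence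
  \<open>D X\<close> is integration against an operator-valued simple function of \<open>X\<close>, whose
  \<open>L\<^sup>2\<close> norm is exactly the 2-variation norm of \<open>D X\<close>.

  A general \<open>X\<close> is the \<open>L\<^sup>2\<close> limit of simple functions of \<open>X\<close>. By
  continuity of the derivative in the 2-variation norm the corresponding simple densities are Cauchy in
  \<open>L\<^sup>2\<close>, and the limit \<open>G(X)\<close> represents \<open>D X\<close>. The measure
  \<open>B \<mapsto> D X (1\<^bsub>{X \<in> B}\<^esub> u)\<close> depends only on the law of \<open>X\<close>, and densities are unique, so
  \<open>G\<close> is the same for all \<open>X\<close> with a given law.
\<close>

text \<open>L(H,U) is in general not separable, so square integrable operator-valued functions are
  out of reach of results for second countable targets. Three devices replace them: measurability is
  asked of \<open>K u\<close> for each fixed u, operator-valued limits are compared only with simple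
  functions, and equality of operators is tested on a countable dense set of directions. The
  2-variation norm sums norms over disjoint pieces. On a simple density this permits the equality
  case of Cauchy-Schwarz on each piece separately, which recovers the full L2 norm. The ordinary
  operator norm of \<open>D X\<close>, where the sum is taken before the norm, can be strictly
  smaller and would not make the densities Cauchy. The approximants of \<open>X\<close> have the
  form T(X) with T a simple Borel map on H. Their densities are then Borel functions on H evaluated
  at \<open>X\<close>, and so is the limit. For X and X' of equal law the maps \<open>D X\<close>
  and \<open>D X'\<close> can be compared only on events {X in B} and {X' in B}. Uniqueness of
  densities carries this comparison to the representation on all of \<open>L2\<close>.\<close>

section \<open>Atomless probability spaces\<close>

text \<open>A splitting of A has a part with at most half of the mass of A. Halving n times leaves a
  set of positive measure at most 1/2^n.\<close>

lemma (in prob_space) atomless_small_subset: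
  assumes "atomless M" "A \<in> sets M" "0 < measure M A" "0 < (e::real)"
  shows "\<exists>B\<in>sets M. B \<subseteq> A \<and> 0 < measure M B \<and> measure M B < e"
proof -
  have halve: "\<exists>B\<in>sets M. B \<subseteq> A \<and> 0 < measure M B \<and> measure M B \<le> measure M A / 2"
    if A: "A \<in> sets M" "0 < measure M A" for A
  proof -
    obtain B where B: "B \<in> sets M" "B \<subseteq> A" "0 < measure M B" "measure M B < measure M A"
      using assms(1) A unfolding atomless_def by blast
    have d: "measure M (A - B) = measure M A - measure M B"
      using A B by (simp add: finite_measure_Diff)
    show ?thesis
    proof (cases "measure M B \<le> measure M A / 2")
      case True then show ?thesis using B by blast
    next
      case False
      then have "A - B \<in> sets M \<and> A - B \<subseteq> A \<and> 0 < measure M (A - B) \<and> measure M (A - B) \<le> measure M A / 2"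
        using A B d by auto
      then show ?thesis by blast
    qed
  qed
  have iter: "\<exists>B\<in>sets M. B \<subseteq> A \<and> 0 < measure M B \<and> measure M B \<le> 1 / 2 ^ n" for n
  proof (induction n)
    case 0
    show ?case using assms by (intro bexI[of _ A]) auto
  next
    case (Suc n)
    then obtain B where B: "B \<in> sets M" "B \<subseteq> A" "0 < measure M B" "measure M B \<le> 1 / 2 ^ n" by blast
    obtain C where "C \<in> sets M" "C \<subseteq> B" "0 < measure M C" "measure M C \<le> measure M B / 2"
      using halve[OF B(1,3)] by blast
    then show ?case using B by (intro bexI[of _ C]) auto
  qed
  obtain n where "1 / 2 ^ n < e"
    using real_arch_pow_inv[of e "1/2"] assms(4) by (auto simp: power_one_over)
  then show ?thesis using iter[of n] by (meson le_less_trans)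
qed

text \<open>Sierpinski's theorem by greedy exhaustion. \<open>S B\<close> holds the admissible
  enlargements of B; each step goes at least halfway from the current measure to the supremum over
  \<open>S B\<close>. If the union stayed below t, a small set of positive measure could be added to
  it and would be admissible at every stage.\<close>

lemma (in prob_space) atomless_subset_measure_eq:
  assumes "atomless M" "A \<in> sets M" "0 \<le> t" "t \<le> measure M A"
  shows "\<exists>B\<in>sets M. B \<subseteq> A \<and> measure M B = t"
proof -
  define S where "S B = {C \<in> sets M. B \<subseteq> C \<and> C \<subseteq> A \<and> measure M C \<le> t}" for B
  have bdd: "bdd_above (measure M ` S B)" for B
    by (intro bdd_aboveI[of _ 1]) auto
  have "\<exists>B. \<forall>n. (B n \<in> S {}) \<and>
      (B n \<subseteq> B (Suc n) \<and> (measure M (B n) + (SUP C\<in>S (B n). measure M C)) / 2 \<le> measure M (B (Suc n)))"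
  proof (rule dependent_nat_choice)
    show "\<exists>B. B \<in> S {}" using assms by (intro exI[of _ "{}"]) (auto simp: S_def)
    fix B n assume B: "B \<in> S {}"
    then have B': "B \<in> S B" by (auto simp: S_def)
    have le: "measure M B \<le> (SUP C\<in>S B. measure M C)" by (rule cSUP_upper[OF B' bdd])
    show "\<exists>C. C \<in> S {} \<and> (B \<subseteq> C \<and> (measure M B + (SUP C\<in>S B. measure M C)) / 2 \<le> measure M C)"
    proof (cases "measure M B < (SUP C\<in>S B. measure M C)")
      case False
      then show ?thesis using B le by (intro exI[of _ B]) auto
    next
      case True
      then have "(measure M B + (SUP C\<in>S B. measure M C)) / 2 < (SUP C\<in>S B. measure M C)" by simp
      then obtain C where "C \<in> S B" "(measure M B + (SUP C\<in>S B. measure M C)) / 2 < measure M C"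
        using less_cSUP_iff[OF _ bdd] B' by blast
      then show ?thesis by (intro exI[of _ C]) (auto simp: S_def)
    qed
  qed
  then obtain B where B: "\<And>n. B n \<in> S {}" "\<And>n. B n \<subseteq> B (Suc n)"
     "\<And>n. (measure M (B n) + (SUP C\<in>S (B n). measure M C)) / 2 \<le> measure M (B (Suc n))" by blast
  define E where "E = (\<Union>n. B n)"
  have Bm: "B n \<in> sets M" "B n \<subseteq> A" "measure M (B n) \<le> t" for n using B(1) by (auto simp: S_def)
  have E: "E \<in> sets M" "E \<subseteq> A" using Bm by (auto simp: E_def)
  have lim: "(\<lambda>n. measure M (B n)) \<longlonglongrightarrow> measure M E"
    unfolding E_def by (rule finite_Lim_measure_incseq) (auto intro!: incseq_SucI B simp: Bm image_subset_iff)
  have Et: "measure M E \<le> t" by (rule LIMSEQ_le_const2[OF lim]) (use Bm in auto)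
  have "measure M E = t"
  proof (rule ccontr)
    assume "measure M E \<noteq> t"
    then have lt: "measure M E < t" using Et by simp
    have "measure M (A - E) = measure M A - measure M E" using E assms by (simp add: finite_measure_Diff)
    then obtain C where C: "C \<in> sets M" "C \<subseteq> A - E" "0 < measure M C" "measure M C < t - measure M E"
      using atomless_small_subset[OF assms(1), of "A - E" "t - measure M E"] lt assms E by auto
    have u: "measure M (E \<union> C) = measure M E + measure M C"
      using C E by (intro finite_measure_Union) auto
    have "E \<union> C \<in> S (B n)" for n
      using C E u unfolding S_def by (auto simp: E_def)
    then have "measure M E + measure M C \<le> (SUP C\<in>S (B n). measure M C)" for n
      unfolding u[symmetric] by (intro cSUP_upper bdd)
    then have "(measure M (B n) + (measure M E + measure M C)) / 2 \<le> measure M (B (Suc n))" for n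
      using B(3)[of n] by (smt (verit) divide_right_mono)
    moreover have "(\<lambda>n. (measure M (B n) + (measure M E + measure M C)) / 2)
        \<longlonglongrightarrow> (measure M E + (measure M E + measure M C)) / 2"
      by (intro tendsto_intros lim) auto
    \<comment> \<open>The halfway rule survives the limit and says that half the measure of C is at
      most 0.\<close>
    ultimately have "(measure M E + (measure M E + measure M C)) / 2 \<le> measure M E"
      using LIMSEQ_le[OF _ LIMSEQ_Suc[OF lim]] by blast
    then show False using C by simp
  qed
  then show ?thesis using E by blast
qed

section \<open>Square integrable functions and bounded linear maps on them\<close>

text \<open>Cauchy-Schwarz from the inequality 2ab <= a^2 + b^2, applied after scaling both
  functions to norm about 1.\<close>

lemma
  fixes f g :: "'a \<Rightarrow> real"
  assumes [measurable]: "f \<in> borel_measurable M" "g \<in> borel_measurable M"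
    and f: "integrable M (\<lambda>x. (f x)\<^sup>2)" and g: "integrable M (\<lambda>x. (g x)\<^sup>2)"
  shows integrable_mult_of_squares: "integrable M (\<lambda>x. f x * g x)"
    and integral_abs_mult_le_sqrt:
      "(\<integral>x. \<bar>f x * g x\<bar> \<partial>M) \<le> sqrt (\<integral>x. (f x)\<^sup>2 \<partial>M) * sqrt (\<integral>x. (g x)\<^sup>2 \<partial>M)"
proof -
  have *: "\<bar>a * b\<bar> \<le> (a\<^sup>2 + b\<^sup>2) / 2" for a b :: real
    using sum_squares_bound[of "\<bar>a\<bar>" "\<bar>b\<bar>"] by (simp add: abs_mult)
  show int: "integrable M (\<lambda>x. f x * g x)"
    by (rule Bochner_Integration.integrable_bound[where f="\<lambda>x. ((f x)\<^sup>2 + (g x)\<^sup>2) / 2"])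
       (use f g * in \<open>auto intro!: AE_I2\<close>)
  define a where "a = sqrt (\<integral>x. (f x)\<^sup>2 \<partial>M)"
  define b where "b = sqrt (\<integral>x. (g x)\<^sup>2 \<partial>M)"
  have a: "0 \<le> a" "a\<^sup>2 = (\<integral>x. (f x)\<^sup>2 \<partial>M)" and b: "0 \<le> b" "b\<^sup>2 = (\<integral>x. (g x)\<^sup>2 \<partial>M)"
    by (auto simp: a_def b_def)
  \<comment> \<open>The shift by e permits the division when one of the norms a, b is zero; it is
    removed by letting e tend to 0.\<close>
  have "(\<integral>x. \<bar>f x * g x\<bar> \<partial>M) \<le> (a + e) * (b + e)" if e: "e > 0" for e
  proof -
    have pos: "a + e > 0" "b + e > 0" using a b e by auto
    have "\<bar>f x * g x\<bar> \<le> (a + e) * (b + e) * (((f x)\<^sup>2 / (a + e)\<^sup>2 + (g x)\<^sup>2 / (b + e)\<^sup>2) / 2)" for x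
    proof -
      have "\<bar>f x * g x\<bar> = (a + e) * (b + e) * \<bar>f x / (a + e) * (g x / (b + e))\<bar>"
        using pos by (simp add: abs_mult)
      also have "\<dots> \<le> (a + e) * (b + e) * (((f x / (a + e))\<^sup>2 + (g x / (b + e))\<^sup>2) / 2)"
        using pos by (intro mult_left_mono *) auto
      finally show ?thesis by (simp add: power_divide)
    qed
    then have "(\<integral>x. \<bar>f x * g x\<bar> \<partial>M)
        \<le> (\<integral>x. (a + e) * (b + e) * (((f x)\<^sup>2 / (a + e)\<^sup>2 + (g x)\<^sup>2 / (b + e)\<^sup>2) / 2) \<partial>M)"
      using f g int by (intro integral_mono) auto
    also have "\<dots> = (a + e) * (b + e) * ((a\<^sup>2 / (a + e)\<^sup>2 + b\<^sup>2 / (b + e)\<^sup>2) / 2)"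
      using f g by (simp add: a b)
    also have "\<dots> \<le> (a + e) * (b + e) * 1"
    proof (intro mult_left_mono)
      have "a\<^sup>2 / (a + e)\<^sup>2 \<le> 1" "b\<^sup>2 / (b + e)\<^sup>2 \<le> 1"
        using pos a(1) b(1) e by (auto simp: divide_le_eq_1 intro!: power_mono)
      then show "(a\<^sup>2 / (a + e)\<^sup>2 + b\<^sup>2 / (b + e)\<^sup>2) / 2 \<le> 1" by simp
    qed (use pos in auto)
    finally show ?thesis by simp
  qed
  moreover have "((\<lambda>e. (a + e) * (b + e)) \<longlongrightarrow> (a + 0) * (b + 0)) (at_right 0)"
    by (intro tendsto_intros)
  ultimately have "(\<integral>x. \<bar>f x * g x\<bar> \<partial>M) \<le> (a + 0) * (b + 0)"
    by (intro tendsto_lowerbound[where F="at_right 0" and f="\<lambda>e. (a + e) * (b + e)"])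
       (auto simp: eventually_at_right_less eventually_at_filter)
  then show "(\<integral>x. \<bar>f x * g x\<bar> \<partial>M) \<le> sqrt (\<integral>x. (f x)\<^sup>2 \<partial>M) * sqrt (\<integral>x. (g x)\<^sup>2 \<partial>M)"
    by (simp add: a_def b_def)
qed

section \<open>Representatives of square integrable functions\<close>

lemma L2D:
  assumes "X \<in> L2 M"
  shows "X \<in> borel_measurable M" "integrable M (\<lambda>\<omega>. (norm (X \<omega>))\<^sup>2)"
  using assms by (auto simp: L2_def)

lemma norm_add_squared_le: "(norm (x + y :: 'a::real_normed_vector))\<^sup>2 \<le> 2 * (norm x)\<^sup>2 + 2 * (norm y)\<^sup>2"
proof -
  have "(norm (x + y))\<^sup>2 \<le> (norm x + norm y)\<^sup>2" by (intro power_mono norm_triangle_ineq) auto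
  also have "\<dots> \<le> 2 * (norm x)\<^sup>2 + 2 * (norm y)\<^sup>2"
    using sum_squares_bound[of "norm x" "norm y"] by (simp add: power2_sum)
  finally show ?thesis .
qed

lemma L2_add:
  assumes "X \<in> L2 M" "Y \<in> L2 M"
  shows "(\<lambda>\<omega>. X \<omega> + Y \<omega>) \<in> L2 M"
proof -
  note [measurable] = L2D(1)[OF assms(1)] L2D(1)[OF assms(2)]
  have "integrable M (\<lambda>\<omega>. (norm (X \<omega> + Y \<omega>))\<^sup>2)"
    by (rule Bochner_Integration.integrable_bound[where f="\<lambda>\<omega>. 2 * (norm (X \<omega>))\<^sup>2 + 2 * (norm (Y \<omega>))\<^sup>2"])
       (auto intro!: L2D(2) assms norm_add_squared_le)
  then show ?thesis by (auto simp: L2_def)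
qed

lemma L2_scaleR: "X \<in> L2 M \<Longrightarrow> (\<lambda>\<omega>. a *\<^sub>R X \<omega>) \<in> L2 M"
  by (auto simp: L2_def power_mult_distrib)

lemma L2_diff: "X \<in> L2 M \<Longrightarrow> Y \<in> L2 M \<Longrightarrow> (\<lambda>\<omega>. X \<omega> - Y \<omega>) \<in> L2 M"
  using L2_add[of X M "\<lambda>\<omega>. (-1) *\<^sub>R Y \<omega>"] L2_scaleR[of Y M "-1"] by simp

lemma L2_zero: "(\<lambda>\<omega>. 0) \<in> L2 M"
  by (auto simp: L2_def)

lemma (in finite_measure) integral_indicator_scaleR:
  fixes u :: "'b::{banach,second_countable_topology}"
  assumes "A \<in> sets M"
  shows "(\<integral>\<omega>. indicator A \<omega> *\<^sub>R u \<partial>M) = measure M A *\<^sub>R u"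
  using assms by (subst integral_scaleR_left) (auto simp: less_top[symmetric])

lemma (in finite_measure) L2_indicator:
  assumes "A \<in> sets M"
  shows "(\<lambda>\<omega>. indicator A \<omega> *\<^sub>R u) \<in> L2 M"
proof -
  have "(norm (indicator A \<omega> *\<^sub>R u))\<^sup>2 = indicator A \<omega> * (norm u)\<^sup>2" for \<omega>
    by (auto simp: indicator_def)
  then show ?thesis using assms by (simp add: L2_def less_top[symmetric])
qed

lemma (in finite_measure) L2_step:
  fixes n :: nat
  assumes "\<And>i. i < n \<Longrightarrow> A i \<in> sets M"
  shows "(\<lambda>\<omega>. \<Sum>i<n. indicator (A i) \<omega> *\<^sub>R x i) \<in> L2 M"
  using assms by (induction n) (auto intro!: L2_add L2_indicator L2_zero)

lemma (in finite_measure) L2norm_indicator: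
  assumes "A \<in> sets M"
  shows "L2norm M (\<lambda>\<omega>. indicator A \<omega> *\<^sub>R u) = sqrt (measure M A) * norm u"
proof -
  have "(norm (indicator A \<omega> *\<^sub>R u))\<^sup>2 = indicator A \<omega> * (norm u)\<^sup>2" for \<omega>
    by (auto simp: indicator_def)
  then show ?thesis using assms by (simp add: L2norm_def real_sqrt_mult)
qed

lemma L2norm_nonneg: "0 \<le> L2norm M X"
  by (simp add: L2norm_def)

lemma L2norm_scaleR: "L2norm M (\<lambda>\<omega>. a *\<^sub>R X \<omega>) = \<bar>a\<bar> * L2norm M X"
  by (simp add: L2norm_def power_mult_distrib) (simp add: real_sqrt_mult)

lemma (in prob_space)
  assumes "X \<in> L2 M"
  shows L2_integrable: "integrable M X"
    and L2_integral_norm_le: "(\<integral>\<omega>. norm (X \<omega>) \<partial>M) \<le> L2norm M X"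
proof -
  note [measurable] = L2D(1)[OF assms]
  have "integrable M (\<lambda>\<omega>. norm (X \<omega>))"
    by (rule square_integrable_imp_integrable) (use L2D(2)[OF assms] in auto)
  then show "integrable M X" by (simp add: integrable_norm_iff)
  show "(\<integral>\<omega>. norm (X \<omega>) \<partial>M) \<le> L2norm M X"
    using integral_abs_mult_le_sqrt[of "\<lambda>\<omega>. norm (X \<omega>)" M "\<lambda>_. 1"] L2D(2)[OF assms]
    by (simp add: L2norm_def prob_space)
qed

lemma L2norm_tendsto_0:
  fixes X :: "'a \<Rightarrow> 'h::{banach,second_countable_topology}"
  assumes X: "X \<in> L2 M" and [measurable]: "\<And>i. F i \<in> borel_measurable M"
    and lim: "\<And>\<omega>. \<omega> \<in> space M \<Longrightarrow> (\<lambda>i. F i \<omega>) \<longlonglongrightarrow> X \<omega>"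
    and bnd: "\<And>i \<omega>. \<omega> \<in> space M \<Longrightarrow> norm (F i \<omega>) \<le> 2 * norm (X \<omega>)"
  shows "\<And>i. F i \<in> L2 M" "(\<lambda>i. L2norm M (\<lambda>\<omega>. F i \<omega> - X \<omega>)) \<longlonglongrightarrow> 0"
proof -
  note [measurable] = L2D(1)[OF X]
  have sq: "(norm (F i \<omega>))\<^sup>2 \<le> 4 * (norm (X \<omega>))\<^sup>2" if "\<omega> \<in> space M" for i \<omega>
    using power_mono[OF bnd[OF that, of i], of 2] by (simp add: power_mult_distrib)
  show "F i \<in> L2 M" for i
  proof -
    have "integrable M (\<lambda>\<omega>. (norm (F i \<omega>))\<^sup>2)"
      by (rule Bochner_Integration.integrable_bound[where f="\<lambda>\<omega>. 4 * (norm (X \<omega>))\<^sup>2"])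
         (use sq L2D(2)[OF X] in auto)
    then show ?thesis by (simp add: L2_def)
  qed
  \<comment> \<open>10 = 2 * 4 + 2, from \<open>norm_add_squared_le\<close> and the factor 4 in
    \<open>sq\<close>.\<close>
  have sq2: "(norm (F i \<omega> - X \<omega>))\<^sup>2 \<le> 10 * (norm (X \<omega>))\<^sup>2" if "\<omega> \<in> space M" for i \<omega>
    using norm_add_squared_le[of "F i \<omega>" "- X \<omega>"] sq[OF that, of i] by simp
  have "(\<lambda>i. \<integral>\<omega>. (norm (F i \<omega> - X \<omega>))\<^sup>2 \<partial>M) \<longlonglongrightarrow> (\<integral>\<omega>. 0 \<partial>M)"
  proof (rule integral_dominated_convergence[where w="\<lambda>\<omega>. 10 * (norm (X \<omega>))\<^sup>2"])
    show "AE \<omega> in M. (\<lambda>i. (norm (F i \<omega> - X \<omega>))\<^sup>2) \<longlonglongrightarrow> 0"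
    proof (rule AE_I2)
      fix \<omega> assume "\<omega> \<in> space M"
      have "(\<lambda>i. (norm (F i \<omega> - X \<omega>))\<^sup>2) \<longlonglongrightarrow> (norm (X \<omega> - X \<omega>))\<^sup>2"
        by (intro tendsto_intros lim) fact
      then show "(\<lambda>i. (norm (F i \<omega> - X \<omega>))\<^sup>2) \<longlonglongrightarrow> 0" by simp
    qed
  qed (use sq2 L2D(2)[OF X] in auto)
  then have "(\<lambda>i. sqrt (\<integral>\<omega>. (norm (F i \<omega> - X \<omega>))\<^sup>2 \<partial>M)) \<longlonglongrightarrow> sqrt 0"
    by (intro tendsto_real_sqrt) simp
  then show "(\<lambda>i. L2norm M (\<lambda>\<omega>. F i \<omega> - X \<omega>)) \<longlonglongrightarrow> 0" by (simp add: L2norm_def)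
qed

text \<open>The pieces are the level sets of F, one for each of its finitely many values. No
  separability of the target is assumed, so this also covers operator-valued functions.\<close>

lemma simple_function_step_representation:
  fixes F :: "'a \<Rightarrow> 'h::real_normed_vector"
  assumes "simple_function M F"
  shows "\<exists>(n::nat) A x. (\<forall>i<n. A i \<in> sets M) \<and> disjoint_family_on A {..<n} \<and>
    (\<forall>\<omega>\<in>space M. F \<omega> = (\<Sum>i<n. indicator (A i) \<omega> *\<^sub>R x i)) \<and>
    (\<forall>i<n. A i = F -` {x i} \<inter> space M) \<and> (\<Union>i<n. A i) = space M"
proof -
  have fin: "finite (F ` space M)" using assms by (rule simple_functionD)
  obtain x where x: "bij_betw x {..<card (F ` space M)} (F ` space M)"
    using ex_bij_betw_nat_finite[OF fin] by (auto simp: atLeast0LessThan)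
  define A where "A i = F -` {x i} \<inter> space M" for i
  show ?thesis
  proof (intro exI conjI allI impI ballI)
    show "A i \<in> sets M" for i unfolding A_def using assms by (rule simple_functionD)
    show "disjoint_family_on A {..<card (F ` space M)}"
      using bij_betw_imp_inj_on[OF x] by (auto simp: disjoint_family_on_def A_def inj_on_def)
    show "\<And>i. A i = F -` {x i} \<inter> space M" by (simp add: A_def)
    have cover: "\<exists>j<card (F ` space M). F \<omega> = x j" if "\<omega> \<in> space M" for \<omega>
      using bij_betw_imp_surj_on[OF x, symmetric] that by (metis imageE image_eqI lessThan_iff)
    then show "(\<Union>i<card (F ` space M). A i) = space M" by (fastforce simp: A_def)
    fix \<omega> assume \<omega>: "\<omega> \<in> space M"
    then obtain j where j: "j < card (F ` space M)" "F \<omega> = x j" using cover by blast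
    have "(\<Sum>i<card (F ` space M). indicator (A i) \<omega> *\<^sub>R x i)
        = (\<Sum>i<card (F ` space M). if i = j then x j else 0)"
      using \<omega> j bij_betw_imp_inj_on[OF x] by (intro sum.cong) (auto simp: A_def inj_on_def indicator_def)
    then show "F \<omega> = (\<Sum>i<card (F ` space M). indicator (A i) \<omega> *\<^sub>R x i)" using j by simp
  qed
qed

lemma L2_step_approximation:
  fixes Y :: "'a \<Rightarrow> 'h::{banach,second_countable_topology}"
  assumes Y: "Y \<in> L2 M"
  obtains n :: "nat \<Rightarrow> nat" and A x where "\<And>k i. i < n k \<Longrightarrow> A k i \<in> sets M"
    "(\<lambda>k. L2norm M (\<lambda>\<omega>. (\<Sum>i<n k. indicator (A k i) \<omega> *\<^sub>R x k i) - Y \<omega>)) \<longlonglongrightarrow> 0"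
    "\<And>\<omega>. \<omega> \<in> space M \<Longrightarrow> (\<lambda>k. \<Sum>i<n k. indicator (A k i) \<omega> *\<^sub>R x k i) \<longlonglongrightarrow> Y \<omega>"
proof -
  obtain F where F: "\<And>k. simple_function M (F k)" "\<And>\<omega>. \<omega> \<in> space M \<Longrightarrow> (\<lambda>k. F k \<omega>) \<longlonglongrightarrow> Y \<omega>"
    "\<And>k \<omega>. \<omega> \<in> space M \<Longrightarrow> norm (F k \<omega>) \<le> 2 * norm (Y \<omega>)"
    using borel_measurable_implies_sequence_metric[OF L2D(1)[OF Y], of 0] unfolding dist_0_norm norm_conv_dist[symmetric] by blast
  have "\<exists>(n::nat) A x. (\<forall>i<n. A i \<in> sets M) \<and> (\<forall>\<omega>\<in>space M. F k \<omega> = (\<Sum>i<n. indicator (A i) \<omega> *\<^sub>R x i))" for k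
    using simple_function_step_representation[OF F(1)[of k]] by blast
  then obtain n :: "nat \<Rightarrow> nat" and A x where nA: "\<And>k i. i < n k \<Longrightarrow> A k i \<in> sets M"
    "\<And>k \<omega>. \<omega> \<in> space M \<Longrightarrow> F k \<omega> = (\<Sum>i<n k. indicator (A k i) \<omega> *\<^sub>R x k i)" by metis
  have "(\<lambda>k. L2norm M (\<lambda>\<omega>. F k \<omega> - Y \<omega>)) \<longlonglongrightarrow> 0"
    by (rule L2norm_tendsto_0(2)[OF Y]) (auto intro: F borel_measurable_simple_function)
  moreover have "L2norm M (\<lambda>\<omega>. F k \<omega> - Y \<omega>)
      = L2norm M (\<lambda>\<omega>. (\<Sum>i<n k. indicator (A k i) \<omega> *\<^sub>R x k i) - Y \<omega>)" for k
    unfolding L2norm_def by (auto intro!: Bochner_Integration.integral_cong arg_cong[where f=sqrt] simp: nA(2))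
  ultimately show thesis
    using F(2) nA by (intro that[of n A x]) (auto simp: nA(2)[symmetric])
qed

section \<open>Bounded linear maps on L2 and the vector measure integral\<close>

context
  fixes M :: "'o measure" and L :: "('o \<Rightarrow> 'h::{banach,second_countable_topology}) \<Rightarrow> 'u::real_normed_vector"
  assumes L: "bounded_linear_L2 M L"
begin

lemma bounded_linear_L2_add: "Y \<in> L2 M \<Longrightarrow> Z \<in> L2 M \<Longrightarrow> L (\<lambda>\<omega>. Y \<omega> + Z \<omega>) = L Y + L Z"
proof -
  assume "Y \<in> L2 M" "Z \<in> L2 M"
  then have "L (\<lambda>\<omega>. 1 *\<^sub>R Y \<omega> + 1 *\<^sub>R Z \<omega>) = 1 *\<^sub>R L Y + 1 *\<^sub>R L Z"
    using L unfolding bounded_linear_L2_def by blast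
  then show ?thesis by simp
qed

lemma bounded_linear_L2_scaleR: "Y \<in> L2 M \<Longrightarrow> L (\<lambda>\<omega>. a *\<^sub>R Y \<omega>) = a *\<^sub>R L Y"
proof -
  assume "Y \<in> L2 M"
  then have "L (\<lambda>\<omega>. a *\<^sub>R Y \<omega> + 0 *\<^sub>R Y \<omega>) = a *\<^sub>R L Y + 0 *\<^sub>R L Y"
    using L unfolding bounded_linear_L2_def by blast
  then show ?thesis by simp
qed

lemma bounded_linear_L2_zero: "L (\<lambda>\<omega>. 0) = 0"
  using bounded_linear_L2_scaleR[OF L2_zero, of 0] by simp

lemma bounded_linear_L2_diff: "Y \<in> L2 M \<Longrightarrow> Z \<in> L2 M \<Longrightarrow> L (\<lambda>\<omega>. Y \<omega> - Z \<omega>) = L Y - L Z"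
  using bounded_linear_L2_add[of Y "\<lambda>\<omega>. (-1) *\<^sub>R Z \<omega>"] bounded_linear_L2_scaleR[of Z "-1"] L2_scaleR[of Z M "-1"]
  by simp

lemma bounded_linear_L2_bound:
  obtains C where "C \<ge> 0" "\<And>Y. Y \<in> L2 M \<Longrightarrow> norm (L Y) \<le> C * L2norm M Y"
proof -
  obtain C where C: "\<And>Y. Y \<in> L2 M \<Longrightarrow> norm (L Y) \<le> C * L2norm M Y"
    using L unfolding bounded_linear_L2_def by blast
  then have "norm (L Y) \<le> \<bar>C\<bar> * L2norm M Y" if "Y \<in> L2 M" for Y
    by (meson L2norm_nonneg abs_ge_self mult_right_mono order_trans that)
  then show thesis using that[of "\<bar>C\<bar>"] by auto
qed

text \<open>Elements of \<open>L2\<close> are functions, not classes. The bound by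
  \<open>L2norm\<close> makes L blind to null sets.\<close>

lemma bounded_linear_L2_AE_cong:
  assumes "Y \<in> L2 M" "Z \<in> L2 M" "AE \<omega> in M. Y \<omega> = Z \<omega>"
  shows "L Y = L Z"
proof -
  obtain C where C: "\<And>Y. Y \<in> L2 M \<Longrightarrow> norm (L Y) \<le> C * L2norm M Y" using bounded_linear_L2_bound by blast
  note [measurable] = L2D(1)[OF assms(1)] L2D(1)[OF assms(2)]
  have "(\<integral>\<omega>. (norm (Y \<omega> - Z \<omega>))\<^sup>2 \<partial>M) = (\<integral>\<omega>. 0 \<partial>M)"
    using assms(3) by (intro integral_cong_AE) auto
  then have "norm (L (\<lambda>\<omega>. Y \<omega> - Z \<omega>)) \<le> C * 0"
    using C[OF L2_diff[OF assms(1,2)]] by (simp add: L2norm_def)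
  then show ?thesis using bounded_linear_L2_diff[OF assms(1,2)] by simp
qed

lemma bounded_linear_L2_tendsto:
  assumes "Y \<in> L2 M" "\<And>k. F k \<in> L2 M" "(\<lambda>k. L2norm M (\<lambda>\<omega>. F k \<omega> - Y \<omega>)) \<longlonglongrightarrow> 0"
  shows "(\<lambda>k. L (F k)) \<longlonglongrightarrow> L Y"
proof -
  obtain C where C: "\<And>Y. Y \<in> L2 M \<Longrightarrow> norm (L Y) \<le> C * L2norm M Y" using bounded_linear_L2_bound by blast
  have "(\<lambda>k. L (F k) - L Y) \<longlonglongrightarrow> 0"
  proof (rule Lim_null_comparison)
    show "\<forall>\<^sub>F k in sequentially. norm (L (F k) - L Y) \<le> C * L2norm M (\<lambda>\<omega>. F k \<omega> - Y \<omega>)"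
      using C[OF L2_diff[OF assms(2,1)]] bounded_linear_L2_diff[OF assms(2,1)] by auto
    show "(\<lambda>k. C * L2norm M (\<lambda>\<omega>. F k \<omega> - Y \<omega>)) \<longlonglongrightarrow> 0"
      using tendsto_mult_left[OF assms(3), of C] by simp
  qed
  then show ?thesis by (rule LIM_zero_cancel)
qed

lemma bounded_linear_L2_step:
  fixes n :: nat
  assumes "finite_measure M" "\<And>i. i < n \<Longrightarrow> A i \<in> sets M"
  shows "L (\<lambda>\<omega>. \<Sum>i<n. indicator (A i) \<omega> *\<^sub>R x i) = (\<Sum>i<n. L (\<lambda>\<omega>. indicator (A i) \<omega> *\<^sub>R x i))"
  using assms(2)
proof (induction n)
  case 0 then show ?case using bounded_linear_L2_zero by simp
next
  case (Suc n)
  then show ?case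
    using bounded_linear_L2_add[OF finite_measure.L2_step[OF assms(1), of n A] finite_measure.L2_indicator[OF assms(1), of "A n"]]
    by simp
qed

lemma bounded_linear_L2_step_tendsto:
  fixes n :: "nat \<Rightarrow> nat"
  assumes "finite_measure M" "Y \<in> L2 M" and A: "\<And>k i. i < n k \<Longrightarrow> A k i \<in> sets M"
    "(\<lambda>k. L2norm M (\<lambda>\<omega>. (\<Sum>i<n k. indicator (A k i) \<omega> *\<^sub>R x k i) - Y \<omega>)) \<longlonglongrightarrow> 0"
  shows "(\<lambda>k. \<Sum>i<n k. L (\<lambda>\<omega>. indicator (A k i) \<omega> *\<^sub>R x k i)) \<longlonglongrightarrow> L Y"
proof -
  have "L (\<lambda>\<omega>. \<Sum>i<n k. indicator (A k i) \<omega> *\<^sub>R x k i) = (\<Sum>i<n k. L (\<lambda>\<omega>. indicator (A k i) \<omega> *\<^sub>R x k i))" for k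
    using A(1) by (intro bounded_linear_L2_step assms(1)) auto
  then show ?thesis
    using bounded_linear_L2_tendsto[OF assms(2) finite_measure.L2_step[OF assms(1)] A(2)] A(1)
    by (simp only:)
qed

text \<open>By additivity the sums in the definition are the values of L at the step functions, also
  when the sets overlap. Continuity of L in \<open>L2\<close> then forces the limit
  \<open>L Y\<close> for every admissible sequence, and \<open>L2_step_approximation\<close>
  supplies one.\<close>

lemma vm_integral_eq:
  assumes "finite_measure M" and Y: "Y \<in> L2 M"
  shows "vm_integral M L Y = L Y"
  unfolding vm_integral_def
proof (rule the_equality)
  obtain n :: "nat \<Rightarrow> nat" and A x where A: "\<And>k i. i < n k \<Longrightarrow> A k i \<in> sets M"
    "(\<lambda>k. L2norm M (\<lambda>\<omega>. (\<Sum>i<n k. indicator (A k i) \<omega> *\<^sub>R x k i) - Y \<omega>)) \<longlonglongrightarrow> 0"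
    "\<And>\<omega>. \<omega> \<in> space M \<Longrightarrow> (\<lambda>k. \<Sum>i<n k. indicator (A k i) \<omega> *\<^sub>R x k i) \<longlonglongrightarrow> Y \<omega>"
    using L2_step_approximation[OF Y] by blast
  have "(\<lambda>k. \<Sum>i<n k. L (\<lambda>\<omega>. indicator (A k i) \<omega> *\<^sub>R x k i)) \<longlonglongrightarrow> L Y"
    by (rule bounded_linear_L2_step_tendsto[OF assms(1) Y A(1,2)])
  then show "\<exists>(n::nat \<Rightarrow> nat) A x. (\<forall>k. \<forall>i<n k. A k i \<in> sets M) \<and>
      (\<lambda>k. L2norm M (\<lambda>\<omega>. (\<Sum>i<n k. indicator (A k i) \<omega> *\<^sub>R x k i) - Y \<omega>)) \<longlonglongrightarrow> 0 \<and>
      (AE \<omega> in M. (\<lambda>k. \<Sum>i<n k. indicator (A k i) \<omega> *\<^sub>R x k i) \<longlonglongrightarrow> Y \<omega>) \<and>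
      (\<lambda>k. \<Sum>i<n k. L (\<lambda>\<omega>. indicator (A k i) \<omega> *\<^sub>R x k i)) \<longlonglongrightarrow> L Y"
    using A by (intro exI[of _ n] exI[of _ A] exI[of _ x]) auto
next
  fix v
  assume "\<exists>(n::nat \<Rightarrow> nat) A x. (\<forall>k. \<forall>i<n k. A k i \<in> sets M) \<and>
      (\<lambda>k. L2norm M (\<lambda>\<omega>. (\<Sum>i<n k. indicator (A k i) \<omega> *\<^sub>R x k i) - Y \<omega>)) \<longlonglongrightarrow> 0 \<and>
      (AE \<omega> in M. (\<lambda>k. \<Sum>i<n k. indicator (A k i) \<omega> *\<^sub>R x k i) \<longlonglongrightarrow> Y \<omega>) \<and>
      (\<lambda>k. \<Sum>i<n k. L (\<lambda>\<omega>. indicator (A k i) \<omega> *\<^sub>R x k i)) \<longlonglongrightarrow> v"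
  then obtain n :: "nat \<Rightarrow> nat" and A x where A: "\<And>k i. i < n k \<Longrightarrow> A k i \<in> sets M"
    "(\<lambda>k. L2norm M (\<lambda>\<omega>. (\<Sum>i<n k. indicator (A k i) \<omega> *\<^sub>R x k i) - Y \<omega>)) \<longlonglongrightarrow> 0"
    "(\<lambda>k. \<Sum>i<n k. L (\<lambda>\<omega>. indicator (A k i) \<omega> *\<^sub>R x k i)) \<longlonglongrightarrow> v" by blast
  have "(\<lambda>k. \<Sum>i<n k. L (\<lambda>\<omega>. indicator (A k i) \<omega> *\<^sub>R x k i)) \<longlonglongrightarrow> L Y"
    by (rule bounded_linear_L2_step_tendsto[OF assms(1) Y A(1,2)])
  then show "v = L Y" using A(3) LIMSEQ_unique by blast
qed

end

text \<open>Step functions are dense and both maps are continuous. This extends the density formula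
  from indicators to all of \<open>L2\<close>.\<close>

lemma bounded_linear_L2_eqI:
  fixes L L' :: "('o \<Rightarrow> 'h::{banach,second_countable_topology}) \<Rightarrow> 'u::real_normed_vector"
  assumes "finite_measure M" "bounded_linear_L2 M L" "bounded_linear_L2 M L'"
    and eq: "\<And>A u. A \<in> sets M \<Longrightarrow> L (\<lambda>\<omega>. indicator A \<omega> *\<^sub>R u) = L' (\<lambda>\<omega>. indicator A \<omega> *\<^sub>R u)"
    and Y: "Y \<in> L2 M"
  shows "L Y = L' Y"
proof -
  obtain n :: "nat \<Rightarrow> nat" and A x where A: "\<And>k i. i < n k \<Longrightarrow> A k i \<in> sets M"
    "(\<lambda>k. L2norm M (\<lambda>\<omega>. (\<Sum>i<n k. indicator (A k i) \<omega> *\<^sub>R x k i) - Y \<omega>)) \<longlonglongrightarrow> 0"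
    by (rule L2_step_approximation[OF Y]) blast
  have "(\<Sum>i<n k. L (\<lambda>\<omega>. indicator (A k i) \<omega> *\<^sub>R x k i))
      = (\<Sum>i<n k. L' (\<lambda>\<omega>. indicator (A k i) \<omega> *\<^sub>R x k i))" for k
    using A(1) eq by (intro sum.cong) auto
  then have "(\<lambda>k. \<Sum>i<n k. L' (\<lambda>\<omega>. indicator (A k i) \<omega> *\<^sub>R x k i)) \<longlonglongrightarrow> L Y"
    using bounded_linear_L2_step_tendsto[OF assms(2,1) Y A] by presburger
  then show ?thesis
    by (rule LIMSEQ_unique) (rule bounded_linear_L2_step_tendsto[OF assms(3,1) Y A])
qed

section \<open>Operator-valued densities and the 2-variation norm\<close>

lemma norm_integral_le_integral:
  fixes f :: "'a \<Rightarrow> 'b::{banach,second_countable_topology}"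
  assumes "integrable M f" "integrable M g" "\<And>x. x \<in> space M \<Longrightarrow> norm (f x) \<le> g x"
  shows "norm (\<integral>x. f x \<partial>M) \<le> (\<integral>x. g x \<partial>M)"
  by (rule order_trans[OF Bochner_Integration.integral_norm_bound integral_mono[OF integrable_norm[OF assms(1)] assms(2,3)]])

text \<open>Measurability in each direction u passes to differences when the target 'u is second
  countable, without any separability of the operator space. Measurability of the operator norm
  itself is contained in the integrability condition.\<close>

definition operator_L2 :: "'o measure \<Rightarrow> ('o \<Rightarrow> 'h::real_normed_vector \<Rightarrow>\<^sub>L 'u::real_normed_vector) \<Rightarrow> bool" where
  "operator_L2 M K \<longleftrightarrow> (\<forall>u. (\<lambda>\<omega>. K \<omega> u) \<in> borel_measurable M) \<and> integrable M (\<lambda>\<omega>. (norm (K \<omega>))\<^sup>2)"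

text \<open>For simple Y the value is selected among countably many maps \<open>K u\<close>.
  Continuity of each operator passes this to pointwise limits.\<close>

lemma borel_measurable_operator_apply:
  fixes K :: "'o \<Rightarrow> 'h::{real_normed_vector,second_countable_topology} \<Rightarrow>\<^sub>L 'u::real_normed_vector"
  assumes K: "\<And>u. (\<lambda>\<omega>. K \<omega> u) \<in> borel_measurable M" and Y: "Y \<in> borel_measurable M"
  shows "(\<lambda>\<omega>. K \<omega> (Y \<omega>)) \<in> borel_measurable M"
proof -
  obtain F where F: "\<And>k. simple_function M (F k)" "\<And>\<omega>. \<omega> \<in> space M \<Longrightarrow> (\<lambda>k. F k \<omega>) \<longlonglongrightarrow> Y \<omega>"
    using borel_measurable_implies_sequence_metric[OF Y, of 0] by blast
  show ?thesis
  proof (rule borel_measurable_LIMSEQ_metric)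
    show "(\<lambda>\<omega>. K \<omega> (F k \<omega>)) \<in> borel_measurable M" for k
    proof (rule measurable_compose_countable'[where I="F k ` space M" and f="\<lambda>u \<omega>. K \<omega> u"])
      show "F k \<in> measurable M (count_space (F k ` space M))"
        using F(1)[of k] by (simp add: simple_function_def measurable_count_space_eq2)
      show "countable (F k ` space M)"
        using F(1)[of k] by (intro countable_finite) (simp add: simple_function_def)
    qed (rule K)
    show "(\<lambda>k. K \<omega> (F k \<omega>)) \<longlonglongrightarrow> K \<omega> (Y \<omega>)" if "\<omega> \<in> space M" for \<omega>
      by (intro tendsto_intros F that)
  qed
qed

lemma operator_L2_norm_measurable:
  assumes "operator_L2 M K"
  shows "(\<lambda>\<omega>. norm (K \<omega>)) \<in> borel_measurable M"
proof -
  have "(\<lambda>\<omega>. (norm (K \<omega>))\<^sup>2) \<in> borel_measurable M"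
    using assms unfolding operator_L2_def by (blast dest: borel_measurable_integrable)
  then have "(\<lambda>\<omega>. sqrt ((norm (K \<omega>))\<^sup>2)) \<in> borel_measurable M" by (rule measurable_compose[OF _ borel_measurable_sqrt])
  then show ?thesis by simp
qed

context
  fixes M :: "'o measure"
    and K :: "'o \<Rightarrow> 'h::{banach,second_countable_topology} \<Rightarrow>\<^sub>L 'u::{banach,second_countable_topology}"
  assumes K: "operator_L2 M K"
begin

lemma
  assumes Y: "Y \<in> L2 M"
  shows operator_L2_integrable: "integrable M (\<lambda>\<omega>. K \<omega> (Y \<omega>))"
    and operator_L2_integral_norm_le: "(\<integral>\<omega>. norm (K \<omega>) * norm (Y \<omega>) \<partial>M) \<le> L2norm M K * L2norm M Y"
    and operator_L2_norm_integral_le: "norm (\<integral>\<omega>. K \<omega> (Y \<omega>) \<partial>M) \<le> L2norm M K * L2norm M Y"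
    and operator_L2_integrable_norm: "integrable M (\<lambda>\<omega>. norm (K \<omega>) * norm (Y \<omega>))"
proof -
  note [measurable] = L2D(1)[OF Y] operator_L2_norm_measurable[OF K]
  have [measurable]: "(\<lambda>\<omega>. K \<omega> (Y \<omega>)) \<in> borel_measurable M"
    by (rule borel_measurable_operator_apply) (use K in \<open>auto simp: operator_L2_def\<close>)
  have K2: "integrable M (\<lambda>\<omega>. (norm (K \<omega>))\<^sup>2)" using K by (simp add: operator_L2_def)
  show int: "integrable M (\<lambda>\<omega>. norm (K \<omega>) * norm (Y \<omega>))"
    by (rule integrable_mult_of_squares) (use K2 L2D(2)[OF Y] in auto)
  show int': "integrable M (\<lambda>\<omega>. K \<omega> (Y \<omega>))"
    by (rule Bochner_Integration.integrable_bound[OF int]) (auto intro!: AE_I2 norm_blinfun)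
  show le: "(\<integral>\<omega>. norm (K \<omega>) * norm (Y \<omega>) \<partial>M) \<le> L2norm M K * L2norm M Y"
    using integral_abs_mult_le_sqrt[OF _ _ K2 L2D(2)[OF Y]] by (simp add: L2norm_def)
  have "norm (\<integral>\<omega>. K \<omega> (Y \<omega>) \<partial>M) \<le> (\<integral>\<omega>. norm (K \<omega>) * norm (Y \<omega>) \<partial>M)"
    using int int' by (intro norm_integral_le_integral) (auto intro!: norm_blinfun)
  with le show "norm (\<integral>\<omega>. K \<omega> (Y \<omega>) \<partial>M) \<le> L2norm M K * L2norm M Y" by simp
qed

lemma operator_L2_bounded_linear: "bounded_linear_L2 M (\<lambda>Y. \<integral>\<omega>. K \<omega> (Y \<omega>) \<partial>M)"
  unfolding bounded_linear_L2_def
proof (intro conjI ballI allI exI)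
  fix Y Z :: "'o \<Rightarrow> 'h" and a b :: real assume Y: "Y \<in> L2 M" and Z: "Z \<in> L2 M"
  have "(\<integral>\<omega>. K \<omega> (a *\<^sub>R Y \<omega> + b *\<^sub>R Z \<omega>) \<partial>M) = (\<integral>\<omega>. a *\<^sub>R K \<omega> (Y \<omega>) + b *\<^sub>R K \<omega> (Z \<omega>) \<partial>M)"
    by (simp add: blinfun.bilinear_simps)
  also have "\<dots> = a *\<^sub>R (\<integral>\<omega>. K \<omega> (Y \<omega>) \<partial>M) + b *\<^sub>R (\<integral>\<omega>. K \<omega> (Z \<omega>) \<partial>M)"
    using operator_L2_integrable[OF Y] operator_L2_integrable[OF Z] by simp
  finally show "(\<integral>\<omega>. K \<omega> (a *\<^sub>R Y \<omega> + b *\<^sub>R Z \<omega>) \<partial>M)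
    = a *\<^sub>R (\<integral>\<omega>. K \<omega> (Y \<omega>) \<partial>M) + b *\<^sub>R (\<integral>\<omega>. K \<omega> (Z \<omega>) \<partial>M)" .
qed (rule operator_L2_norm_integral_le)

end

text \<open>At each point at most one summand is nonzero. The squared form turns the constraint
  inside \<open>tnorm\<close> into a weighted sum of the squared norms of the
  \<open>x i\<close>.\<close>

lemma norm_disjoint_step:
  fixes x :: "nat \<Rightarrow> 'a::real_normed_vector"
  assumes "disjoint_family_on A {..<n}"
  shows "norm (\<Sum>i<n. indicator (A i) \<omega> *\<^sub>R x i) = (\<Sum>i<n. indicator (A i) \<omega> * norm (x i))"
    "(norm (\<Sum>i<n. indicator (A i) \<omega> *\<^sub>R x i))\<^sup>2 = (\<Sum>i<n. indicator (A i) \<omega> * (norm (x i))\<^sup>2)"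
proof -
  have "norm (\<Sum>i<n. indicator (A i) \<omega> *\<^sub>R x i) = (\<Sum>i<n. indicator (A i) \<omega> * norm (x i)) \<and>
    (norm (\<Sum>i<n. indicator (A i) \<omega> *\<^sub>R x i))\<^sup>2 = (\<Sum>i<n. indicator (A i) \<omega> * (norm (x i))\<^sup>2)"
  proof (cases "\<exists>j<n. \<omega> \<in> A j")
    case True
    then obtain j where j: "j < n" "\<omega> \<in> A j" by blast
    have ind: "indicator (A i) \<omega> = (if i = j then 1 else 0 :: real)" if "i < n" for i
      using assms j that by (auto simp: disjoint_family_on_def indicator_def)
    have "(\<Sum>i<n. indicator (A i) \<omega> *\<^sub>R x i) = (\<Sum>i<n. if i = j then x j else 0)"
      using ind by (intro sum.cong) auto
    moreover have "(\<Sum>i<n. indicator (A i) \<omega> * norm (x i)) = (\<Sum>i<n. if i = j then norm (x j) else 0)"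
      using ind by (intro sum.cong) auto
    moreover have "(\<Sum>i<n. indicator (A i) \<omega> * (norm (x i))\<^sup>2) = (\<Sum>i<n. if i = j then (norm (x j))\<^sup>2 else 0)"
      using ind by (intro sum.cong) auto
    ultimately show ?thesis using j by simp
  next
    case False
    then have "indicator (A i) \<omega> = (0::real)" if "i < n" for i using that by (auto simp: indicator_def)
    then show ?thesis by simp
  qed
  then show "norm (\<Sum>i<n. indicator (A i) \<omega> *\<^sub>R x i) = (\<Sum>i<n. indicator (A i) \<omega> * norm (x i))"
    "(norm (\<Sum>i<n. indicator (A i) \<omega> *\<^sub>R x i))\<^sup>2 = (\<Sum>i<n. indicator (A i) \<omega> * (norm (x i))\<^sup>2)" by auto
qed

section \<open>The 2-variation norm of a map with an operator density\<close>

lemma tnorm_leI: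
  assumes "\<And>n (A::nat \<Rightarrow> 'o set) (x::nat \<Rightarrow> 'h::real_normed_vector).
      (\<And>i. i < n \<Longrightarrow> A i \<in> sets M) \<Longrightarrow> disjoint_family_on A {..<n} \<Longrightarrow>
      (\<integral>\<omega>. (norm (\<Sum>i<n. indicator (A i) \<omega> *\<^sub>R x i))\<^sup>2 \<partial>M) \<le> 1 \<Longrightarrow>
      (\<Sum>i<n. norm (L (\<lambda>\<omega>. indicator (A i) \<omega> *\<^sub>R x i))) \<le> c"
  shows "tnorm M L \<le> ereal c"
  unfolding tnorm_def
proof (rule SUP_least)
  fix p assume "p \<in> {(n::nat, A::nat \<Rightarrow> 'o set, x::nat \<Rightarrow> 'h).
        (\<forall>i<n. A i \<in> sets M) \<and> disjoint_family_on A {..<n} \<and>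
        (\<integral>\<omega>. (norm (\<Sum>i<n. indicator (A i) \<omega> *\<^sub>R x i))\<^sup>2 \<partial>M) \<le> 1}"
  then obtain n A x where p: "p = (n, A, x)" "\<forall>i<n. A i \<in> sets M" "disjoint_family_on A {..<n}"
        "(\<integral>\<omega>. (norm (\<Sum>i<n. indicator (A i) \<omega> *\<^sub>R x i))\<^sup>2 \<partial>M) \<le> 1" by (cases p) blast
  show "(case p of (n, A, x) \<Rightarrow> ereal (\<Sum>i<n. norm (L (\<lambda>\<omega>. indicator (A i) \<omega> *\<^sub>R x i)))) \<le> ereal c"
    unfolding p(1) prod.case ereal_less_eq by (rule assms) (use p in blast)+
qed

lemma tnorm_upper:
  fixes n :: nat
  assumes "\<And>i. i < n \<Longrightarrow> A i \<in> sets M" "disjoint_family_on A {..<n}"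
    "(\<integral>\<omega>. (norm (\<Sum>i<n. indicator (A i) \<omega> *\<^sub>R x i))\<^sup>2 \<partial>M) \<le> 1"
  shows "ereal (\<Sum>i<n. norm (L (\<lambda>\<omega>. indicator (A i) \<omega> *\<^sub>R x i))) \<le> tnorm M L"
  unfolding tnorm_def by (rule SUP_upper2[of "(n, A, x)"]) (use assms in blast, simp)

lemma tnorm_nonneg: "0 \<le> tnorm M L"
  using tnorm_upper[of 0 "\<lambda>_. {}" M "\<lambda>_. 0" L] by (simp add: disjoint_family_on_def zero_ereal_def)

text \<open>Since the sets are disjoint, the norms of the pieces add up to the integral of
  \<open>norm (K _)\<close> against the norm of the whole step function. Cauchy-Schwarz does the
  rest.\<close>

lemma tnorm_operator_le:
  fixes K :: "'o \<Rightarrow> 'h::{banach,second_countable_topology} \<Rightarrow>\<^sub>L 'u::{banach,second_countable_topology}"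
  assumes "finite_measure M" and K: "operator_L2 M K"
    and L: "\<And>A u. A \<in> sets M \<Longrightarrow> L (\<lambda>\<omega>. indicator A \<omega> *\<^sub>R u) = (\<integral>\<omega>. K \<omega> (indicator A \<omega> *\<^sub>R u) \<partial>M)"
  shows "tnorm M L \<le> ereal (L2norm M K)"
proof (rule tnorm_leI)
  interpret finite_measure M by fact
  fix n A and x :: "nat \<Rightarrow> 'h"
  assume A: "\<And>i. i < n \<Longrightarrow> A i \<in> sets M" and dis: "disjoint_family_on A {..<n}"
    and le1: "(\<integral>\<omega>. (norm (\<Sum>i<n. indicator (A i) \<omega> *\<^sub>R x i))\<^sup>2 \<partial>M) \<le> 1"
  have int: "integrable M (\<lambda>\<omega>. norm (K \<omega>) * norm (indicator (A i) \<omega> *\<^sub>R x i))" if "i < n" for i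
    by (rule operator_L2_integrable_norm[OF K L2_indicator[OF A[OF that]]])
  have "norm (L (\<lambda>\<omega>. indicator (A i) \<omega> *\<^sub>R x i))
      \<le> (\<integral>\<omega>. norm (K \<omega>) * norm (indicator (A i) \<omega> *\<^sub>R x i) \<partial>M)" if "i < n" for i
    unfolding L[OF A[OF that]]
    by (rule norm_integral_le_integral[OF operator_L2_integrable[OF K L2_indicator[OF A[OF that]]] int[OF that]])
       (rule norm_blinfun)
  then have "(\<Sum>i<n. norm (L (\<lambda>\<omega>. indicator (A i) \<omega> *\<^sub>R x i)))
      \<le> (\<Sum>i<n. \<integral>\<omega>. norm (K \<omega>) * norm (indicator (A i) \<omega> *\<^sub>R x i) \<partial>M)"
    by (intro sum_mono) auto
  also have "\<dots> = (\<integral>\<omega>. (\<Sum>i<n. norm (K \<omega>) * norm (indicator (A i) \<omega> *\<^sub>R x i)) \<partial>M)"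
    using int by (intro Bochner_Integration.integral_sum[symmetric]) auto
  also have "\<dots> = (\<integral>\<omega>. norm (K \<omega>) * norm (\<Sum>i<n. indicator (A i) \<omega> *\<^sub>R x i) \<partial>M)"
    unfolding norm_disjoint_step(1)[OF dis] sum_distrib_left norm_scaleR by simp
  also have "\<dots> \<le> L2norm M K * L2norm M (\<lambda>\<omega>. \<Sum>i<n. indicator (A i) \<omega> *\<^sub>R x i)"
    by (rule operator_L2_integral_norm_le[OF K L2_step[OF A]])
  also have "\<dots> \<le> L2norm M K * 1"
    using le1 by (intro mult_left_mono L2norm_nonneg) (simp only: L2norm_def real_sqrt_le_1_iff)
  finally show "(\<Sum>i<n. norm (L (\<lambda>\<omega>. indicator (A i) \<omega> *\<^sub>R x i))) \<le> L2norm M K" by simp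
qed

text \<open>An operator norm need not be attained, hence the factor c. If no vector worked, c times
  the norm of k would itself be a bound for k, and smaller than its norm.\<close>

lemma blinfun_almost_norming:
  fixes k :: "'h::real_normed_vector \<Rightarrow>\<^sub>L 'u::real_normed_vector"
  assumes "c < 1"
  shows "\<exists>x. norm x \<le> 1 \<and> c * norm k \<le> norm (k x)"
proof (cases "c * norm k \<le> 0")
  case True
  then show ?thesis by (intro exI[of _ 0]) (auto intro: order_trans)
next
  case False
  then have pos: "norm k > 0" "c > 0" by (auto simp: not_le zero_less_mult_iff)
  have "\<exists>x. c * norm k * norm x < norm (k x)"
  proof (rule ccontr)
    assume "\<nexists>x. c * norm k * norm x < norm (k x)"
    then have "norm k \<le> c * norm k" using pos by (intro norm_blinfun_bound) (auto simp: not_less)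
    then show False using assms pos by simp
  qed
  then obtain x where x: "c * norm k * norm x < norm (k x)" by blast
  then have "x \<noteq> 0" by auto
  then have "c * norm k \<le> norm (k (x /\<^sub>R norm x))"
    using x by (simp add: blinfun.scaleR_right divide_simps mult.commute)
  then show ?thesis using \<open>x \<noteq> 0\<close> by (intro exI[of _ "x /\<^sub>R norm x"]) auto
qed

text \<open>On each level set of K take a vector that almost realises the norm of the value of K
  there, with a weight that produces equality in Cauchy-Schwarz. Simplicity of K makes this a
  legitimate finite test family for \<open>tnorm\<close>.\<close>

lemma L2norm_simple_operator_le_tnorm:
  fixes K :: "'o \<Rightarrow> 'h::{banach,second_countable_topology} \<Rightarrow>\<^sub>L 'u::{banach,second_countable_topology}"
  assumes "finite_measure M" and K: "simple_function M K"
    and L: "\<And>A u. A \<in> sets M \<Longrightarrow> L (\<lambda>\<omega>. indicator A \<omega> *\<^sub>R u) = (\<integral>\<omega>. K \<omega> (indicator A \<omega> *\<^sub>R u) \<partial>M)"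
  shows "ereal (L2norm M K) \<le> tnorm M L"
proof (cases "L2norm M K = 0")
  case True
  then show ?thesis using tnorm_nonneg[of M L] by (simp add: zero_ereal_def)
next
  case False
  interpret finite_measure M by fact
  define N where "N = L2norm M K"
  have N: "N > 0" using False L2norm_nonneg[of M K] by (simp add: N_def)
  obtain n :: nat and A k where *: "\<forall>i<n. A i \<in> sets M" "disjoint_family_on A {..<n}"
    "\<forall>\<omega>\<in>space M. K \<omega> = (\<Sum>i<n. indicator (A i) \<omega> *\<^sub>R k i)" "\<forall>i<n. A i = K -` {k i} \<inter> space M"
    using simple_function_step_representation[OF K] by blast
  note A = *(1)[rule_format] and dis = *(2) and Keq = *(3)[rule_format] and Kval = *(4)[rule_format]
  have intA: "integrable M (\<lambda>\<omega>. indicator (A i) \<omega> * (c::real))" if "i < n" for i c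
    using A[OF that] by (intro integrable_mult_left integrable_real_indicator) (auto simp: less_top[symmetric])
  have "N\<^sup>2 = (\<integral>\<omega>. (norm (K \<omega>))\<^sup>2 \<partial>M)" by (simp add: N_def L2norm_def)
  also have "\<dots> = (\<integral>\<omega>. (\<Sum>i<n. indicator (A i) \<omega> * (norm (k i))\<^sup>2) \<partial>M)"
    by (intro Bochner_Integration.integral_cong refl) (simp only: Keq norm_disjoint_step(2)[OF dis])
  also have "\<dots> = (\<Sum>i<n. measure M (A i) * (norm (k i))\<^sup>2)"
    using A intA by (subst Bochner_Integration.integral_sum) auto
  finally have N2: "N\<^sup>2 = (\<Sum>i<n. measure M (A i) * (norm (k i))\<^sup>2)" .
  have main: "ereal (c * N) \<le> tnorm M L" if c: "c < 1" for c
  proof -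
    obtain x where x: "\<And>i. norm (x i) \<le> 1" "\<And>i. c * norm (k i) \<le> norm (k i (x i))"
      using choice[of "\<lambda>i x. norm x \<le> 1 \<and> c * norm (k i) \<le> norm (k i x)"] blinfun_almost_norming[OF c] by blast
    \<comment> \<open>Equality in Cauchy-Schwarz wants \<open>norm (y i)\<close> proportional to
      \<open>norm (k i)\<close>. Division by N keeps the second moment at most 1.\<close>
    define y where "y i = (norm (k i) / N) *\<^sub>R x i" for i
    have ny: "norm (y i) \<le> norm (k i) / N" for i
      using x(1)[of i] N by (simp add: y_def divide_simps mult_left_le)
    have "(\<integral>\<omega>. (norm (\<Sum>i<n. indicator (A i) \<omega> *\<^sub>R y i))\<^sup>2 \<partial>M) = (\<Sum>i<n. measure M (A i) * (norm (y i))\<^sup>2)"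
      unfolding norm_disjoint_step(2)[OF dis]
      using A intA by (subst Bochner_Integration.integral_sum) auto
    also have "\<dots> \<le> (\<Sum>i<n. measure M (A i) * (norm (k i) / N)\<^sup>2)"
      by (intro sum_mono mult_left_mono power_mono ny) auto
    also have "\<dots> = (\<Sum>i<n. measure M (A i) * (norm (k i))\<^sup>2) / N\<^sup>2" by (simp add: power_divide sum_divide_distrib)
    also have "\<dots> = N\<^sup>2 / N\<^sup>2" by (simp only: N2)
    finally have "(\<integral>\<omega>. (norm (\<Sum>i<n. indicator (A i) \<omega> *\<^sub>R y i))\<^sup>2 \<partial>M) \<le> 1" using N by simp
    then have upper: "ereal (\<Sum>i<n. norm (L (\<lambda>\<omega>. indicator (A i) \<omega> *\<^sub>R y i))) \<le> tnorm M L"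
      by (intro tnorm_upper A dis)
    have "c * (measure M (A i) * (norm (k i))\<^sup>2) / N \<le> norm (L (\<lambda>\<omega>. indicator (A i) \<omega> *\<^sub>R y i))"
      if i: "i < n" for i
    proof -
      have "L (\<lambda>\<omega>. indicator (A i) \<omega> *\<^sub>R y i) = (\<integral>\<omega>. indicator (A i) \<omega> *\<^sub>R k i (y i) \<partial>M)"
        unfolding L[OF A[OF i]] by (intro Bochner_Integration.integral_cong refl) (auto simp: Kval[OF i] indicator_def)
      also have "\<dots> = measure M (A i) *\<^sub>R k i (y i)" by (rule integral_indicator_scaleR[OF A[OF i]])
      also have "norm \<dots> = measure M (A i) * (norm (k i) / N) * norm (k i (x i))"
        using N by (simp add: y_def blinfun.scaleR_right)
      also have "\<dots> \<ge> measure M (A i) * (norm (k i) / N) * (c * norm (k i))"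
        using N by (intro mult_left_mono x) auto
      finally show ?thesis by (simp add: power2_eq_square mult_ac)
    qed
    then have lower: "(\<Sum>i<n. c * (measure M (A i) * (norm (k i))\<^sup>2) / N) \<le> (\<Sum>i<n. norm (L (\<lambda>\<omega>. indicator (A i) \<omega> *\<^sub>R y i)))"
      by (intro sum_mono) auto
    have "(\<Sum>i<n. c * (measure M (A i) * (norm (k i))\<^sup>2) / N) = c * N\<^sup>2 / N"
      unfolding N2 sum_distrib_left sum_divide_distrib ..
    also have "\<dots> = c * N"
      using N by (simp add: power2_eq_square)
    finally show ?thesis using order_trans[OF _ upper, of "ereal (c * N)"] lower by (simp only: ereal_less_eq)
  qed
  \<comment> \<open>Otherwise some real r lies strictly between \<open>tnorm M L\<close> and N, and
    \<open>main\<close> with c = r / N < 1 contradicts this.\<close>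
  show ?thesis
  proof (rule ccontr)
    assume "\<not> ereal (L2norm M K) \<le> tnorm M L"
    then obtain r where r: "tnorm M L < ereal r" "ereal r < ereal N"
      using ereal_dense2[of "tnorm M L" "ereal N"] by (auto simp: N_def not_le)
    then have "ereal (r / N * N) \<le> tnorm M L" using N by (intro main) (simp add: divide_less_eq)
    then show False using r N by simp
  qed
qed

section \<open>Rearrangement invariance\<close>

text \<open>Both sides are the derivative at t = 0 of the same curve. The base points may differ;
  this is what compares \<open>D X\<close> with \<open>D X'\<close> when the laws agree.\<close>

lemma frechet_L2_eq_of_eq_along_lines:
  fixes F :: "('o \<Rightarrow> 'h::{banach,second_countable_topology}) \<Rightarrow> 'u::real_normed_vector"
  assumes L: "frechet_L2 M F X L" and L': "frechet_L2 M F X' L'"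
    and Y: "Y \<in> L2 M" and Y': "Y' \<in> L2 M"
    and eq: "\<And>t. F (\<lambda>\<omega>. X \<omega> + t *\<^sub>R Y \<omega>) = F (\<lambda>\<omega>. X' \<omega> + t *\<^sub>R Y' \<omega>)"
  shows "L Y = L' Y'"
proof -
  define a where "a = L2norm M Y"
  define b where "b = L2norm M Y'"
  have ab: "0 \<le> a" "0 \<le> b" by (auto simp: a_def b_def L2norm_nonneg)
  have bl: "bounded_linear_L2 M L" "bounded_linear_L2 M L'" using L L' by (auto simp: frechet_L2_def)
  have F0: "F X = F X'" using eq[of 0] by simp
  have "norm (L Y - L' Y') \<le> e * (a + b)" if e: "e > 0" for e
  proof -
    obtain d where d: "d > 0" "\<And>Y. Y \<in> L2 M \<Longrightarrow> L2norm M Y < d \<Longrightarrow>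
        norm (F (\<lambda>\<omega>. X \<omega> + Y \<omega>) - F X - L Y) \<le> e * L2norm M Y"
      using L e unfolding frechet_L2_def by blast
    obtain d' where d': "d' > 0" "\<And>Y. Y \<in> L2 M \<Longrightarrow> L2norm M Y < d' \<Longrightarrow>
        norm (F (\<lambda>\<omega>. X' \<omega> + Y \<omega>) - F X' - L' Y) \<le> e * L2norm M Y"
      using L' e unfolding frechet_L2_def by blast
    \<comment> \<open>Small enough for both differentiability estimates at once; the summand 1 keeps
      the denominator positive. Division by t below leaves the bound e * (a + b).\<close>
    define t where "t = min d d' / (1 + a + b)"
    have t: "t > 0" using d d' ab by (simp add: t_def)
    have "t * (1 + a + b) = min d d'" using ab by (simp add: t_def)
    moreover have "t * a < t * (1 + a + b)" "t * b < t * (1 + a + b)" using t ab by auto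
    ultimately have ta: "t * a < d" "t * b < d'" by auto
    have 1: "norm (F (\<lambda>\<omega>. X \<omega> + t *\<^sub>R Y \<omega>) - F X - t *\<^sub>R L Y) \<le> e * (t * a)"
      using d(2)[OF L2_scaleR[OF Y, of t]] t ta(1)
      by (simp add: L2norm_scaleR a_def bounded_linear_L2_scaleR[OF bl(1) Y])
    have 2: "norm (F (\<lambda>\<omega>. X \<omega> + t *\<^sub>R Y \<omega>) - F X - t *\<^sub>R L' Y') \<le> e * (t * b)"
      using d'(2)[OF L2_scaleR[OF Y', of t]] t ta(2)
      by (simp add: L2norm_scaleR b_def bounded_linear_L2_scaleR[OF bl(2) Y'] eq F0)
    have "t *\<^sub>R (L Y - L' Y') = (F (\<lambda>\<omega>. X \<omega> + t *\<^sub>R Y \<omega>) - F X - t *\<^sub>R L' Y')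
        - (F (\<lambda>\<omega>. X \<omega> + t *\<^sub>R Y \<omega>) - F X - t *\<^sub>R L Y)" by (simp add: algebra_simps)
    then have "norm (t *\<^sub>R (L Y - L' Y')) \<le> e * (t * b) + e * (t * a)"
      using order_trans[OF norm_triangle_ineq4 add_mono[OF 2 1]] by (simp only:)
    then have "t * norm (L Y - L' Y') \<le> t * (e * (a + b))" using t by (simp add: ring_distribs mult_ac)
    then show ?thesis using t by simp
  qed
  moreover have "((\<lambda>e. e * (a + b)) \<longlongrightarrow> 0 * (a + b)) (at_right 0)" by (intro tendsto_intros)
  ultimately have "norm (L Y - L' Y') \<le> 0 * (a + b)"
    by (intro tendsto_lowerbound[where F="at_right 0" and f="\<lambda>e. e * (a + b)"])
       (auto simp: eventually_at_filter)
  then show ?thesis by simp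
qed

text \<open>Adding w on a part A of {X = x} transports the mass of A from the point x to x + w. The
  new law therefore sees only the size of A.\<close>

lemma (in finite_measure) distr_add_indicator_eq:
  fixes X :: "'a \<Rightarrow> 'h::{real_normed_vector,second_countable_topology}"
  assumes X[measurable]: "X \<in> borel_measurable M"
    and A: "A \<in> sets M" "A \<subseteq> X -` {x}" and A': "A' \<in> sets M" "A' \<subseteq> X -` {x}"
    and eq: "measure M A = measure M A'"
  shows "distr M borel (\<lambda>\<omega>. X \<omega> + indicator A \<omega> *\<^sub>R w) = distr M borel (\<lambda>\<omega>. X \<omega> + indicator A' \<omega> *\<^sub>R w)"
proof (rule measure_eqI)
  have *: "emeasure (distr M borel (\<lambda>\<omega>. X \<omega> + indicator A \<omega> *\<^sub>R w)) B
      = ennreal (measure M (X -` B \<inter> space M) - (if x \<in> B then measure M A else 0)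
          + (if x + w \<in> B then measure M A else 0))"
    if B[measurable]: "B \<in> sets borel" and A[measurable]: "A \<in> sets M" and sub: "A \<subseteq> X -` {x}" for A B
  proof -
    have AS: "A \<subseteq> space M" using sets.sets_into_space[OF A] .
    have XB: "X -` B \<inter> space M \<in> sets M" by measurable
    have "(\<lambda>\<omega>. X \<omega> + indicator A \<omega> *\<^sub>R w) -` B \<inter> space M
        = (X -` B \<inter> space M - A) \<union> (if x + w \<in> B then A else {})"
    proof (rule set_eqI)
      show "\<omega> \<in> (\<lambda>\<omega>. X \<omega> + indicator A \<omega> *\<^sub>R w) -` B \<inter> space M
        \<longleftrightarrow> \<omega> \<in> (X -` B \<inter> space M - A) \<union> (if x + w \<in> B then A else {})" for \<omega>
        using sub AS by (cases "\<omega> \<in> A") auto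
    qed
    moreover have "measure M ((X -` B \<inter> space M - A) \<union> (if x + w \<in> B then A else {}))
        = measure M (X -` B \<inter> space M - A) + measure M (if x + w \<in> B then A else {})"
      using XB A by (intro finite_measure_Union) auto
    moreover have "measure M (X -` B \<inter> space M - A) = measure M (X -` B \<inter> space M) - (if x \<in> B then measure M A else 0)"
    proof (cases "x \<in> B")
      case True
      then have "A \<subseteq> X -` B \<inter> space M" using sub AS by auto
      then show ?thesis using True XB A by (simp add: finite_measure_Diff)
    next
      case False
      then have "X -` B \<inter> space M - A = X -` B \<inter> space M" using sub by auto
      then show ?thesis using False by simp
    qed
    ultimately show ?thesis by (simp add: emeasure_distr emeasure_eq_measure)
  qed
  show "emeasure (distr M borel (\<lambda>\<omega>. X \<omega> + indicator A \<omega> *\<^sub>R w)) B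
      = emeasure (distr M borel (\<lambda>\<omega>. X \<omega> + indicator A' \<omega> *\<^sub>R w)) B"
    if "B \<in> sets (distr M borel (\<lambda>\<omega>. X \<omega> + indicator A \<omega> *\<^sub>R w))" for B
    using that *[of B A] *[of B A'] A A' eq by simp
qed simp

text \<open>By invariance phi is a function psi of the measure alone. Atomlessness supplies sets of
  every size up to \<open>measure M E\<close>, so additivity becomes Cauchy's functional equation on
  an interval. The square root bound gives continuity at 0 and excludes the irregular solutions. The
  conclusion is multiplied out so that it also makes sense for a null set E.\<close>

lemma (in prob_space) additive_rearrangement_invariant_proportional:
  fixes \<phi> :: "'a set \<Rightarrow> 'u::real_normed_vector"
  assumes atomless: "atomless M" and E: "E \<in> sets M"
    and add: "\<And>A B. A \<in> sets M \<Longrightarrow> B \<in> sets M \<Longrightarrow> A \<subseteq> E \<Longrightarrow> B \<subseteq> E \<Longrightarrow> A \<inter> B = {} \<Longrightarrow> \<phi> (A \<union> B) = \<phi> A + \<phi> B"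
    and inv: "\<And>A B. A \<in> sets M \<Longrightarrow> B \<in> sets M \<Longrightarrow> A \<subseteq> E \<Longrightarrow> B \<subseteq> E \<Longrightarrow> measure M A = measure M B \<Longrightarrow> \<phi> A = \<phi> B"
    and bnd: "\<And>A. A \<in> sets M \<Longrightarrow> A \<subseteq> E \<Longrightarrow> norm (\<phi> A) \<le> C * sqrt (measure M A)"
    and A: "A \<in> sets M" "A \<subseteq> E"
  shows "measure M E *\<^sub>R \<phi> A = measure M A *\<^sub>R \<phi> E"
proof -
  define p where "p = measure M E"
  \<comment> \<open>Any subset of E of measure s serves; \<open>inv\<close> makes the choice
    immaterial.\<close>
  define \<psi> where "\<psi> s = \<phi> (SOME B. B \<in> sets M \<and> B \<subseteq> E \<and> measure M B = s)" for s
  have \<psi>_eq: "\<psi> (measure M B) = \<phi> B" if "B \<in> sets M" "B \<subseteq> E" for B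
  proof -
    have "\<exists>B'. B' \<in> sets M \<and> B' \<subseteq> E \<and> measure M B' = measure M B" using that by blast
    from someI_ex[OF this] show ?thesis unfolding \<psi>_def using that by (intro inv) auto
  qed
  have \<psi>_add: "\<psi> (s + t) = \<psi> s + \<psi> t" if st: "0 \<le> s" "0 \<le> t" "s + t \<le> p" for s t
  proof -
    obtain B where B: "B \<in> sets M" "B \<subseteq> E" "measure M B = s + t"
      using atomless_subset_measure_eq[OF atomless E, of "s + t"] st by (auto simp: p_def)
    obtain B' where B': "B' \<in> sets M" "B' \<subseteq> B" "measure M B' = s"
      using atomless_subset_measure_eq[OF atomless B(1), of s] st B by auto
    have "measure M (B - B') = t" using B B' by (simp add: finite_measure_Diff)
    moreover have "\<phi> (B' \<union> (B - B')) = \<phi> B' + \<phi> (B - B')" using B B' by (intro add) auto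
    moreover have "B' \<union> (B - B') = B" "B' \<subseteq> E" "B - B' \<subseteq> E" using B B' by auto
    ultimately show ?thesis using \<psi>_eq[of B] \<psi>_eq[of B'] \<psi>_eq[of "B - B'"] B B' by auto
  qed
  have \<psi>_bnd: "norm (\<psi> s) \<le> \<bar>C\<bar> * sqrt s" if s: "0 \<le> s" "s \<le> p" for s
  proof -
    obtain B where B: "B \<in> sets M" "B \<subseteq> E" "measure M B = s"
      using atomless_subset_measure_eq[OF atomless E, of s] s by (auto simp: p_def)
    have "norm (\<psi> s) \<le> C * sqrt s" using bnd[OF B(1,2)] \<psi>_eq[OF B(1,2)] B(3) by simp
    also have "\<dots> \<le> \<bar>C\<bar> * sqrt s" using s by (intro mult_right_mono) auto
    finally show ?thesis .
  qed
  have \<psi>0: "\<psi> 0 = 0" using \<psi>_add[of 0 0] by (simp add: p_def)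
  have \<psi>_mult: "\<psi> (real k * s) = real k *\<^sub>R \<psi> s" if "0 \<le> s" "real k * s \<le> p" for k s
    using that
  proof (induction k)
    case 0 then show ?case using \<psi>0 by simp
  next
    case (Suc k)
    then have "real k * s + s \<le> p" by (simp add: algebra_simps)
    then show ?case using Suc \<psi>_add[of "real k * s" s] by (simp add: algebra_simps)
  qed
  define s where "s = measure M A"
  have s: "0 \<le> s" "s \<le> p" using A E by (auto simp: s_def p_def intro: finite_measure_mono)
  have step: "norm (s *\<^sub>R \<psi> p - p *\<^sub>R \<psi> s) \<le> (p / real (Suc n)) * norm (\<psi> p) + p * (\<bar>C\<bar> * sqrt (p / real (Suc n)))" for n
  proof (cases "p = 0")
    case True
    then show ?thesis using s by simp
  next
    case False
    \<comment> \<open>A grid of n + 1 equal steps on [0, p]: s is k full steps and a remainder r <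
      h. Additivity handles the steps exactly, and the bound on psi controls the remainder.\<close>
    define h where "h = p / real (Suc n)"
    have p: "p > 0" using False by (simp add: p_def zero_less_measure_iff)
    then have h: "h > 0" "real (Suc n) * h = p" by (auto simp: h_def)
    define k where "k = nat \<lfloor>s / h\<rfloor>"
    define r where "r = s - real k * h"
    have "real k = of_int \<lfloor>s / h\<rfloor>" using s h by (simp add: k_def)
    then have "real k \<le> s / h" "s / h < real k + 1" by linarith+
    then have r: "0 \<le> r" "r < h" using h by (auto simp: r_def field_simps)
    have hp: "h \<le> p" using h p by (simp add: h_def divide_le_eq)
    have "\<psi> p = real (Suc n) *\<^sub>R \<psi> h" using \<psi>_mult[of h "Suc n"] h by simp
    moreover have "\<psi> s = real k *\<^sub>R \<psi> h + \<psi> r"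
      using \<psi>_add[of "real k * h" r] \<psi>_mult[of h k] r h s by (simp add: r_def)
    \<comment> \<open>This is the coefficient of psi h that survives in s psi p - p psi s. Since (n
      + 1) psi h = psi p, it contributes r psi p.\<close>
    moreover have "s * real (Suc n) - p * real k = r * real (Suc n)"
      unfolding r_def h(2)[symmetric] by (simp add: algebra_simps)
    ultimately have "s *\<^sub>R \<psi> p - p *\<^sub>R \<psi> s = r *\<^sub>R \<psi> p - p *\<^sub>R \<psi> r"
      by (simp add: scaleR_add_right scaleR_diff_left[symmetric] diff_diff_add[symmetric] del: of_nat_Suc)
    then have "norm (s *\<^sub>R \<psi> p - p *\<^sub>R \<psi> s) \<le> r * norm (\<psi> p) + p * norm (\<psi> r)"
      using norm_triangle_ineq4[of "r *\<^sub>R \<psi> p" "p *\<^sub>R \<psi> r"] r p by simp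
    also have "\<dots> \<le> h * norm (\<psi> p) + p * (\<bar>C\<bar> * sqrt h)"
    proof (intro add_mono mult_mono)
      have "norm (\<psi> r) \<le> \<bar>C\<bar> * sqrt r" using r hp by (intro \<psi>_bnd) auto
      also have "\<dots> \<le> \<bar>C\<bar> * sqrt h" using r by (intro mult_left_mono) auto
      finally show "norm (\<psi> r) \<le> \<bar>C\<bar> * sqrt h" .
    qed (use r h p in auto)
    finally show ?thesis by (simp add: h_def)
  qed
  have lim: "(\<lambda>n. p / real (Suc n)) \<longlonglongrightarrow> 0"
    using tendsto_mult_left[OF LIMSEQ_inverse_real_of_nat, of p] by (simp add: divide_inverse)
  have "(\<lambda>n. (p / real (Suc n)) * norm (\<psi> p) + p * (\<bar>C\<bar> * sqrt (p / real (Suc n))))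
      \<longlonglongrightarrow> 0 * norm (\<psi> p) + p * (\<bar>C\<bar> * sqrt 0)"
    by (intro tendsto_intros lim)
  then have "norm (s *\<^sub>R \<psi> p - p *\<^sub>R \<psi> s) \<le> 0 * norm (\<psi> p) + p * (\<bar>C\<bar> * sqrt 0)"
    by (rule LIMSEQ_le_const) (use step in blast)
  then show ?thesis using \<psi>_eq[OF A] \<psi>_eq[OF E] by (simp add: s_def p_def)
qed

lemma (in finite_measure) bounded_linear_L2_indicator:
  assumes L: "bounded_linear_L2 M L" and E: "E \<in> sets M"
  shows "bounded_linear (\<lambda>u. L (\<lambda>\<omega>. indicator E \<omega> *\<^sub>R u))"
proof -
  obtain C where C: "\<And>Y. Y \<in> L2 M \<Longrightarrow> norm (L Y) \<le> C * L2norm M Y" using bounded_linear_L2_bound[OF L] by blast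
  show ?thesis
  proof (rule bounded_linear_intro)
    show "L (\<lambda>\<omega>. indicator E \<omega> *\<^sub>R (u + v)) = L (\<lambda>\<omega>. indicator E \<omega> *\<^sub>R u) + L (\<lambda>\<omega>. indicator E \<omega> *\<^sub>R v)" for u v
      using bounded_linear_L2_add[OF L L2_indicator[OF E, of u] L2_indicator[OF E, of v]] by (simp add: scaleR_add_right)
    show "L (\<lambda>\<omega>. indicator E \<omega> *\<^sub>R (r *\<^sub>R u)) = r *\<^sub>R L (\<lambda>\<omega>. indicator E \<omega> *\<^sub>R u)" for r u
      using bounded_linear_L2_scaleR[OF L L2_indicator[OF E, of u], of r] by (simp add: mult.commute)
    show "norm (L (\<lambda>\<omega>. indicator E \<omega> *\<^sub>R u)) \<le> norm u * (C * sqrt (measure M E))" for u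
      using C[OF L2_indicator[OF E, of u]] L2norm_indicator[OF E, of u] by (simp add: mult_ac)
  qed
qed

text \<open>On each level set of X the map A -> L (1_A u) is proportional to the measure of A, and
  the factor, linear and bounded in u, is the value of the density there. It is indexed by the value
  of X so that the density is a function of X.\<close>

lemma (in prob_space) simple_rearrangement_invariant_density:
  fixes L :: "('a \<Rightarrow> 'h::{banach,second_countable_topology}) \<Rightarrow> 'u::{banach,second_countable_topology}"
    and X :: "'a \<Rightarrow> 'b::real_normed_vector"
  assumes "atomless M" and L: "bounded_linear_L2 M L" and X: "simple_function M X"
    and inv: "\<And>x A A' u. A \<in> sets M \<Longrightarrow> A' \<in> sets M \<Longrightarrow> A \<subseteq> X -` {x} \<Longrightarrow> A' \<subseteq> X -` {x} \<Longrightarrow>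
      measure M A = measure M A' \<Longrightarrow> L (\<lambda>\<omega>. indicator A \<omega> *\<^sub>R u) = L (\<lambda>\<omega>. indicator A' \<omega> *\<^sub>R u)"
  shows "\<exists>k. \<forall>A\<in>sets M. \<forall>u. L (\<lambda>\<omega>. indicator A \<omega> *\<^sub>R u)
    = (\<integral>\<omega>. blinfun_apply (k (X \<omega>)) (indicator A \<omega> *\<^sub>R u) \<partial>M)"
proof -
  \<comment> \<open>The average of L over the level set at x. On a null level set division by zero
    makes it 0.\<close>
  define k where "k x = Blinfun (\<lambda>u. L (\<lambda>\<omega>. indicator (X -` {x} \<inter> space M) \<omega> *\<^sub>R u)) /\<^sub>R measure M (X -` {x} \<inter> space M)" for x
  obtain C where C: "\<And>Y. Y \<in> L2 M \<Longrightarrow> norm (L Y) \<le> C * L2norm M Y" using bounded_linear_L2_bound[OF L] by blast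
  obtain n :: nat and E x where *: "\<forall>i<n. E i \<in> sets M" "disjoint_family_on E {..<n}"
    "\<forall>i<n. E i = X -` {x i} \<inter> space M" "(\<Union>i<n. E i) = space M"
    using simple_function_step_representation[OF X] by blast
  note E = *(1)[rule_format] and dis = *(2) and Eeq = *(3)[rule_format] and cover = *(4)
  show ?thesis
  proof (intro exI ballI allI)
    fix A and u :: 'h assume A: "A \<in> sets M"
    define \<phi> where "\<phi> B = L (\<lambda>\<omega>. indicator B \<omega> *\<^sub>R u)" for B
    have AE: "A \<inter> E i \<in> sets M" if "i < n" for i using A E that by auto
    have bnd: "norm (\<phi> B) \<le> (C * norm u) * sqrt (measure M B)" if "B \<in> sets M" for B
      using C[OF L2_indicator[OF that, of u]] L2norm_indicator[OF that, of u] by (simp add: \<phi>_def mult_ac)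
    have scaled: "\<phi> (A \<inter> E i) = measure M (A \<inter> E i) *\<^sub>R k (x i) u" if i: "i < n" for i
    proof -
      have propor: "measure M (E i) *\<^sub>R \<phi> (A \<inter> E i) = measure M (A \<inter> E i) *\<^sub>R \<phi> (E i)"
      proof (rule additive_rearrangement_invariant_proportional[OF assms(1) E[OF i]])
        show "\<phi> (B \<union> B') = \<phi> B + \<phi> B'" if "B \<in> sets M" "B' \<in> sets M" "B \<inter> B' = {}" for B B'
        proof -
          have "(\<lambda>\<omega>. indicator (B \<union> B') \<omega> *\<^sub>R u) = (\<lambda>\<omega>. indicator B \<omega> *\<^sub>R u + indicator B' \<omega> *\<^sub>R u)"
            using that(3) by (auto simp: indicator_def fun_eq_iff)
          then show ?thesis unfolding \<phi>_def
            using bounded_linear_L2_add[OF L L2_indicator[OF that(1), of u] L2_indicator[OF that(2), of u]] by simp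
        qed
        show "\<phi> B = \<phi> B'" if "B \<in> sets M" "B' \<in> sets M" "B \<subseteq> E i" "B' \<subseteq> E i" "measure M B = measure M B'" for B B'
          unfolding \<phi>_def using that Eeq[OF i] by (intro inv[of _ _ "x i"]) auto
        show "norm (\<phi> B) \<le> (C * norm u) * sqrt (measure M B)" if "B \<in> sets M" for B by (rule bnd[OF that])
      qed (use AE[OF i] in auto)
      have kx: "k (x i) u = \<phi> (E i) /\<^sub>R measure M (E i)"
        using bounded_linear_L2_indicator[OF L E[OF i]]
        by (simp add: k_def Eeq[OF i, symmetric] scaleR_blinfun.rep_eq bounded_linear_Blinfun_apply \<phi>_def)
      show ?thesis
      proof (cases "measure M (E i) = 0")
        \<comment> \<open>Proportionality says nothing on a null level set, but there the square
          root bound makes phi vanish.\<close>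
        case True
        then have "measure M (A \<inter> E i) = 0"
          using finite_measure_mono[OF _ E[OF i], of "A \<inter> E i"] by (simp add: measure_le_0_iff)
        then show ?thesis using bnd[OF AE[OF i]] by simp
      next
        case False
        have "\<phi> (A \<inter> E i) = (measure M (E i) *\<^sub>R \<phi> (A \<inter> E i)) /\<^sub>R measure M (E i)" using False by simp
        then show ?thesis unfolding propor kx by simp
      qed
    qed
    \<comment> \<open>Generic in the target, since it is applied both to the vector u and to the
      values \<open>k (x i) u\<close>.\<close>
    have split: "(\<Sum>i<n. indicator (A \<inter> E i) \<omega> *\<^sub>R v i) = indicator A \<omega> *\<^sub>R v j"
      if "j < n" "\<omega> \<in> E j" for j \<omega> and v :: "nat \<Rightarrow> 'c::real_vector"
    proof -
      have "(\<Sum>i<n. indicator (A \<inter> E i) \<omega> *\<^sub>R v i) = (\<Sum>i<n. if i = j then indicator A \<omega> *\<^sub>R v j else 0)"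
        using that dis by (intro sum.cong) (auto simp: indicator_def disjoint_family_on_def)
      then show ?thesis using that by simp
    qed
    have ex: "\<exists>j<n. \<omega> \<in> E j" if "\<omega> \<in> space M" for \<omega> using cover that by auto
    have "L (\<lambda>\<omega>. indicator A \<omega> *\<^sub>R u) = L (\<lambda>\<omega>. \<Sum>i<n. indicator (A \<inter> E i) \<omega> *\<^sub>R u)"
    proof (rule bounded_linear_L2_AE_cong[OF L L2_indicator[OF A] L2_step[OF AE]])
      show "AE \<omega> in M. indicator A \<omega> *\<^sub>R u = (\<Sum>i<n. indicator (A \<inter> E i) \<omega> *\<^sub>R u)"
      proof (rule AE_I2)
        fix \<omega> assume "\<omega> \<in> space M"
        then obtain j where "j < n" "\<omega> \<in> E j" using ex by blast
        then show "indicator A \<omega> *\<^sub>R u = (\<Sum>i<n. indicator (A \<inter> E i) \<omega> *\<^sub>R u)" by (rule split[symmetric])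
      qed
    qed auto
    also have "\<dots> = (\<Sum>i<n. \<phi> (A \<inter> E i))"
      unfolding \<phi>_def by (rule bounded_linear_L2_step[OF L finite_measure_axioms AE])
    also have "\<dots> = (\<Sum>i<n. \<integral>\<omega>. indicator (A \<inter> E i) \<omega> *\<^sub>R k (x i) u \<partial>M)"
      by (intro sum.cong refl) (use AE in \<open>simp only: scaled integral_indicator_scaleR lessThan_iff\<close>)
    also have "\<dots> = (\<integral>\<omega>. (\<Sum>i<n. indicator (A \<inter> E i) \<omega> *\<^sub>R k (x i) u) \<partial>M)"
      using AE by (intro Bochner_Integration.integral_sum[symmetric]) (auto intro!: L2_integrable L2_indicator)
    also have "\<dots> = (\<integral>\<omega>. k (X \<omega>) (indicator A \<omega> *\<^sub>R u) \<partial>M)"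
    proof (rule Bochner_Integration.integral_cong[OF refl])
      fix \<omega> assume \<omega>: "\<omega> \<in> space M"
      then obtain j where j: "j < n" "\<omega> \<in> E j" using ex by blast
      then have "X \<omega> = x j" using Eeq by auto
      then show "(\<Sum>i<n. indicator (A \<inter> E i) \<omega> *\<^sub>R k (x i) u) = k (X \<omega>) (indicator A \<omega> *\<^sub>R u)"
        using split[OF j, of "\<lambda>i. k (x i) u"] by (simp only: blinfun.scaleR_right)
    qed
    finally show "L (\<lambda>\<omega>. indicator A \<omega> *\<^sub>R u) = (\<integral>\<omega>. k (X \<omega>) (indicator A \<omega> *\<^sub>R u) \<partial>M)" .
  qed
qed

section \<open>Limits of simple operator-valued functions\<close>

lemma simple_function_measurable_compose:
  assumes g: "simple_function N g" and X: "X \<in> measurable M N"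
  shows "simple_function M (\<lambda>\<omega>. g (X \<omega>))"
  unfolding simple_function_def
proof (intro conjI ballI)
  have "(\<lambda>\<omega>. g (X \<omega>)) ` space M \<subseteq> g ` space N" using measurable_space[OF X] by auto
  then show "finite ((\<lambda>\<omega>. g (X \<omega>)) ` space M)" using g finite_subset by (auto simp: simple_function_def)
  show "(\<lambda>\<omega>. g (X \<omega>)) -` {y} \<inter> space M \<in> sets M" for y
  proof -
    have "(\<lambda>\<omega>. g (X \<omega>)) -` {y} \<inter> space M = X -` (g -` {y} \<inter> space N) \<inter> space M"
      using measurable_space[OF X] by auto
    then show ?thesis using measurable_sets[OF X simple_functionD(2)[OF g]] by simp
  qed
qed

text \<open>Subtracting a constant is continuous, and s selects among finitely many constants. This
  avoids measurability of a difference in a non-separable space.\<close>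

lemma borel_measurable_norm_diff_simple:
  fixes G s :: "'a \<Rightarrow> 'b::real_normed_vector"
  assumes G: "G \<in> borel_measurable M" and s: "simple_function M s"
  shows "(\<lambda>x. norm (G x - s x)) \<in> borel_measurable M"
proof (rule measurable_compose_countable'[where I="s ` space M" and f="\<lambda>t x. norm (G x - t)"])
  show "(\<lambda>x. norm (G x - t)) \<in> borel_measurable M" for t
    by (rule measurable_compose[OF G]) (intro borel_measurable_continuous_onI continuous_intros)
  show "s \<in> measurable M (count_space (s ` space M))"
    using s by (simp add: simple_function_def measurable_count_space_eq2)
  show "countable (s ` space M)" using s by (intro countable_finite) (simp add: simple_function_def)
qed

lemma borel_measurable_blinfun_apply_const:
  fixes G :: "'a \<Rightarrow> 'b::real_normed_vector \<Rightarrow>\<^sub>L 'c::real_normed_vector"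
  assumes "G \<in> borel_measurable M"
  shows "(\<lambda>x. G x u) \<in> borel_measurable M"
  by (rule measurable_compose[OF assms]) (intro borel_measurable_continuous_onI continuous_intros)

lemma (in finite_measure) integrable_norm_squared_simple:
  fixes s :: "'a \<Rightarrow> 'b::real_normed_vector"
  assumes "simple_function M s"
  shows "integrable M (\<lambda>x. (norm (s x))\<^sup>2)"
proof -
  have *: "simple_function M (\<lambda>x. (norm (s x))\<^sup>2)" by (rule simple_function_compose1[OF assms])
  then have "finite ((\<lambda>x. (norm (s x))\<^sup>2) ` space M)" by (simp add: simple_function_def)
  then have "bounded ((\<lambda>x. (norm (s x))\<^sup>2) ` space M)" by (rule finite_imp_bounded)
  then obtain B where "\<And>x. x \<in> space M \<Longrightarrow> norm ((norm (s x))\<^sup>2) \<le> B" by (auto simp: bounded_iff)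
  then show ?thesis
    by (intro integrable_const_bound[where B=B] AE_I2 borel_measurable_simple_function[OF *])
qed

text \<open>Minkowski's inequality: after expanding the square the mixed term is bounded by
  Cauchy-Schwarz. The scalar form suffices, as it is applied to operator norms.\<close>

lemma sqrt_integral_add_squared_le:
  fixes f g :: "'a \<Rightarrow> real"
  assumes [measurable]: "f \<in> borel_measurable M" "g \<in> borel_measurable M"
    and f: "integrable M (\<lambda>x. (f x)\<^sup>2)" and g: "integrable M (\<lambda>x. (g x)\<^sup>2)"
  shows "sqrt (\<integral>x. (f x + g x)\<^sup>2 \<partial>M) \<le> sqrt (\<integral>x. (f x)\<^sup>2 \<partial>M) + sqrt (\<integral>x. (g x)\<^sup>2 \<partial>M)"
proof -
  define a where "a = sqrt (\<integral>x. (f x)\<^sup>2 \<partial>M)"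
  define b where "b = sqrt (\<integral>x. (g x)\<^sup>2 \<partial>M)"
  have ab: "0 \<le> a" "0 \<le> b" "a\<^sup>2 = (\<integral>x. (f x)\<^sup>2 \<partial>M)" "b\<^sup>2 = (\<integral>x. (g x)\<^sup>2 \<partial>M)"
    by (auto simp: a_def b_def)
  note fg = integrable_mult_of_squares[OF assms]
  have "(\<integral>x. (f x + g x)\<^sup>2 \<partial>M) = (\<integral>x. (f x)\<^sup>2 + (g x)\<^sup>2 + 2 * (f x * g x) \<partial>M)"
    by (simp add: power2_sum mult.assoc)
  also have "\<dots> = a\<^sup>2 + b\<^sup>2 + 2 * (\<integral>x. f x * g x \<partial>M)" using f g fg by (simp add: ab)
  also have "(\<integral>x. f x * g x \<partial>M) \<le> (\<integral>x. \<bar>f x * g x\<bar> \<partial>M)" using fg by (intro integral_mono) auto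
  also have "\<dots> \<le> a * b" unfolding a_def b_def by (rule integral_abs_mult_le_sqrt[OF assms])
  finally have "(\<integral>x. (f x + g x)\<^sup>2 \<partial>M) \<le> (a + b)\<^sup>2" by (simp add: power2_sum mult.assoc)
  then show ?thesis using real_sqrt_le_mono[of _ "(a + b)\<^sup>2"] ab by (fastforce simp: a_def b_def)
qed

text \<open>The space of bounded operators is not separable, so the completeness argument for
  \<open>L\<^sup>2\<close> is carried out on simple functions and their pointwise limits.\<close>

lemma (in prob_space) operator_L2_limit_of_simple:
  fixes h :: "nat \<Rightarrow> 'b::topological_space \<Rightarrow> 'h::real_normed_vector \<Rightarrow>\<^sub>L 'u::{banach,second_countable_topology}"
  assumes X: "X \<in> borel_measurable M" and h: "\<And>j. simple_function borel (h j)"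
    and cauchy: "\<And>i j. L2norm M (\<lambda>\<omega>. h i (X \<omega>) - h j (X \<omega>)) \<le> 1 / 2 ^ i + 1 / 2 ^ j"
  shows "\<exists>G. G \<in> borel_measurable borel \<and> operator_L2 M (\<lambda>\<omega>. G (X \<omega>)) \<and>
    (\<forall>j. operator_L2 M (\<lambda>\<omega>. G (X \<omega>) - h j (X \<omega>))) \<and>
    (\<forall>j. L2norm M (\<lambda>\<omega>. G (X \<omega>) - h j (X \<omega>)) \<le> 2 / 2 ^ j)"
proof -
  define d where "d i j x = norm (h i x - h j x)" for i j x
  have d_simple: "simple_function borel (d i j)" for i j
    unfolding d_def by (rule simple_function_compose2[OF h h])
  have d_meas[measurable]: "d i j \<in> borel_measurable borel" for i j
    by (rule borel_measurable_simple_function[OF d_simple])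
  note X[measurable]
  \<comment> \<open>The set of convergence, described by the real functions \<open>d i j\<close>
    alone. These are simple, so C is a Borel set although the values of h lie in a non-separable
    space.\<close>
  define C where "C = {x. \<forall>m. \<exists>N. \<forall>i\<ge>N. \<forall>j\<ge>N. d i j x < inverse (real (Suc m))}"
  have C: "C \<in> sets borel" unfolding C_def by measurable
  have C_iff: "x \<in> C \<longleftrightarrow> Cauchy (\<lambda>j. h j x)" for x
    unfolding C_def d_def metric_Cauchy_iff2 dist_norm by simp
  \<comment> \<open>The value 0 off C makes the sequence converge everywhere, so that G is a genuine
    pointwise limit of Borel maps.\<close>
  define G where "G x = lim (\<lambda>j. if x \<in> C then h j x else 0)" for x
  have G_lim: "(\<lambda>j. if x \<in> C then h j x else 0) \<longlonglongrightarrow> G x" for x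
    unfolding G_def by (cases "x \<in> C") (auto simp: C_iff Cauchy_convergent convergent_LIMSEQ_iff[symmetric])
  have G_meas: "G \<in> borel_measurable borel"
  proof (rule borel_measurable_LIMSEQ_metric[OF _ G_lim])
    show "(\<lambda>x. if x \<in> C then h j x else 0) \<in> borel_measurable borel" for j
      by (rule measurable_If_set) (use C borel_measurable_simple_function[OF h, of j] in auto)
  qed
  define e where "e j x = norm (G x - h j x)" for j x
  have e_meas[measurable]: "e j \<in> borel_measurable borel" for j
    unfolding e_def by (rule borel_measurable_norm_diff_simple[OF G_meas h])
  have d_int: "integrable M (\<lambda>\<omega>. (d i j (X \<omega>))\<^sup>2)" for i j
    using integrable_norm_squared_simple[OF simple_function_measurable_compose[OF d_simple X, of i j]] by simp
  have d_L2: "sqrt (\<integral>\<omega>. (d i j (X \<omega>))\<^sup>2 \<partial>M) \<le> 1 / 2 ^ i + 1 / 2 ^ j" for i j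
    using cauchy[of i j] by (simp add: L2norm_def d_def)
  \<comment> \<open>Consecutive differences have summable L1 norms, so the telescoping series
    converges absolutely almost surely. Completeness of the operator space is used in the norm
    topology.\<close>
  have AE_C: "AE \<omega> in M. X \<omega> \<in> C"
  proof -
    have int1: "(\<integral>\<^sup>+\<omega>. ennreal (d (Suc j) j (X \<omega>)) \<partial>M) \<le> ennreal (2 * (1 / 2) ^ j)" for j
    proof -
      have L: "(\<lambda>\<omega>. d (Suc j) j (X \<omega>)) \<in> L2 M" using d_int[of "Suc j" j] by (simp add: L2_def)
      have "(\<integral>\<^sup>+\<omega>. ennreal (d (Suc j) j (X \<omega>)) \<partial>M) = ennreal (\<integral>\<omega>. d (Suc j) j (X \<omega>) \<partial>M)"
        by (rule nn_integral_eq_integral[OF L2_integrable[OF L]]) (simp add: d_def)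
      also have "(\<integral>\<omega>. d (Suc j) j (X \<omega>) \<partial>M) \<le> 1 / 2 ^ Suc j + 1 / 2 ^ j"
        using L2_integral_norm_le[OF L] d_L2[of "Suc j" j] by (simp add: L2norm_def d_def)
      also have "\<dots> \<le> 2 * (1 / 2) ^ j" by (simp add: power_one_over field_simps)
      finally show ?thesis by (simp add: ennreal_leI)
    qed
    have "(\<integral>\<^sup>+\<omega>. (\<Sum>j. ennreal (d (Suc j) j (X \<omega>))) \<partial>M) = (\<Sum>j. \<integral>\<^sup>+\<omega>. ennreal (d (Suc j) j (X \<omega>)) \<partial>M)"
      by (rule nn_integral_suminf) measurable
    also have "\<dots> \<le> (\<Sum>j. ennreal (2 * (1 / 2) ^ j))" by (intro suminf_le int1) auto
    also have "\<dots> = ennreal (\<Sum>j. 2 * (1 / 2) ^ j)"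
      by (intro suminf_ennreal2 summable_mult summable_geometric) auto
    finally have "(\<integral>\<^sup>+\<omega>. (\<Sum>j. ennreal (d (Suc j) j (X \<omega>))) \<partial>M) \<noteq> \<infinity>" by (auto simp: top_unique)
    then have "AE \<omega> in M. (\<Sum>j. ennreal (d (Suc j) j (X \<omega>))) \<noteq> \<infinity>"
      by (intro nn_integral_PInf_AE) auto
    then show ?thesis
    proof eventually_elim
      case (elim \<omega>)
      then have "summable (\<lambda>j. d (Suc j) j (X \<omega>))"
        by (intro summable_suminf_not_top) (auto simp: d_def)
      then have "summable (\<lambda>j. h (Suc j) (X \<omega>) - h j (X \<omega>))"
        unfolding d_def by (rule summable_norm_cancel)
      then have "convergent (\<lambda>n. \<Sum>j<n. h (Suc j) (X \<omega>) - h j (X \<omega>))" by (simp add: summable_iff_convergent)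
      then have "convergent (\<lambda>n. h n (X \<omega>) - h 0 (X \<omega>))" by (simp add: sum_lessThan_telescope[of "\<lambda>n. h n (X \<omega>)"])
      then have "convergent (\<lambda>n. h n (X \<omega>))" by (simp add: convergent_diff_const_right_iff)
      then show ?case by (simp add: C_iff convergent_Cauchy)
    qed
  qed
  \<comment> \<open>Fatou's lemma along indices j + i: there \<open>d_L2\<close> is at most 1 / 2^(j
    + i) + 1 / 2^i, which is at most 2 / 2^i.\<close>
  have e_bound: "(\<integral>\<^sup>+\<omega>. ennreal ((e i (X \<omega>))\<^sup>2) \<partial>M) \<le> ennreal ((2 / 2 ^ i)\<^sup>2)" for i
  proof -
    have "(\<integral>\<^sup>+\<omega>. ennreal ((e i (X \<omega>))\<^sup>2) \<partial>M) = (\<integral>\<^sup>+\<omega>. liminf (\<lambda>j. ennreal ((d (j + i) i (X \<omega>))\<^sup>2)) \<partial>M)"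
    proof (rule nn_integral_cong_AE)
      show "AE \<omega> in M. ennreal ((e i (X \<omega>))\<^sup>2) = liminf (\<lambda>j. ennreal ((d (j + i) i (X \<omega>))\<^sup>2))"
        using AE_C
      proof eventually_elim
        case (elim \<omega>)
        then have "(\<lambda>j. h j (X \<omega>)) \<longlonglongrightarrow> G (X \<omega>)" using G_lim[of "X \<omega>"] by simp
        then have "(\<lambda>j. h (j + i) (X \<omega>)) \<longlonglongrightarrow> G (X \<omega>)" by (rule LIMSEQ_ignore_initial_segment)
        then have "(\<lambda>j. ennreal ((d (j + i) i (X \<omega>))\<^sup>2)) \<longlonglongrightarrow> ennreal ((e i (X \<omega>))\<^sup>2)"
          unfolding d_def e_def by (intro tendsto_intros)
        then show ?case by (rule lim_imp_Liminf[OF sequentially_bot, symmetric])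
      qed
    qed
    also have "\<dots> \<le> liminf (\<lambda>j. \<integral>\<^sup>+\<omega>. ennreal ((d (j + i) i (X \<omega>))\<^sup>2) \<partial>M)"
      by (rule nn_integral_liminf) measurable
    also have "\<dots> \<le> limsup (\<lambda>j. \<integral>\<^sup>+\<omega>. ennreal ((d (j + i) i (X \<omega>))\<^sup>2) \<partial>M)"
      by (rule Liminf_le_Limsup) simp
    also have "\<dots> \<le> ennreal ((2 / 2 ^ i)\<^sup>2)"
    proof (rule Limsup_bounded, rule always_eventually, rule allI)
      fix j
      have "(\<integral>\<^sup>+\<omega>. ennreal ((d (j + i) i (X \<omega>))\<^sup>2) \<partial>M) = ennreal (\<integral>\<omega>. (d (j + i) i (X \<omega>))\<^sup>2 \<partial>M)"
        by (rule nn_integral_eq_integral[OF d_int]) simp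
      also have "\<dots> \<le> ennreal ((2 / 2 ^ i)\<^sup>2)"
      proof (rule ennreal_leI)
        have "1 / 2 ^ (j + i) \<le> (1 / 2 ^ i :: real)" by (intro divide_left_mono power_increasing) auto
        then have "sqrt (\<integral>\<omega>. (d (j + i) i (X \<omega>))\<^sup>2 \<partial>M) \<le> 2 / 2 ^ i" using d_L2[of "j + i" i] by simp
        then show "(\<integral>\<omega>. (d (j + i) i (X \<omega>))\<^sup>2 \<partial>M) \<le> (2 / 2 ^ i)\<^sup>2" by (rule sqrt_le_D)
      qed
      finally show "(\<integral>\<^sup>+\<omega>. ennreal ((d (j + i) i (X \<omega>))\<^sup>2) \<partial>M) \<le> ennreal ((2 / 2 ^ i)\<^sup>2)" .
    qed
    finally show ?thesis .
  qed
  have e_int: "integrable M (\<lambda>\<omega>. (e i (X \<omega>))\<^sup>2)" for i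
    by (rule integrableI_nonneg) (use le_less_trans[OF e_bound] in auto)
  have "ennreal (\<integral>\<omega>. (e i (X \<omega>))\<^sup>2 \<partial>M) \<le> ennreal ((2 / 2 ^ i)\<^sup>2)" for i
    using e_bound[of i] nn_integral_eq_integral[OF e_int] by simp
  then have e_L2: "(\<integral>\<omega>. (e i (X \<omega>))\<^sup>2 \<partial>M) \<le> (2 / 2 ^ i)\<^sup>2" for i
    by (subst (asm) ennreal_le_iff) auto
  have hX: "(\<lambda>\<omega>. h j (X \<omega>) u) \<in> borel_measurable M" for j u
    using borel_measurable_blinfun_apply_const[OF borel_measurable_simple_function[OF simple_function_measurable_compose[OF h X]]] .
  have GX': "(\<lambda>\<omega>. G (X \<omega>)) \<in> borel_measurable M" by (rule measurable_compose[OF X G_meas])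
  have GX: "(\<lambda>\<omega>. G (X \<omega>) u) \<in> borel_measurable M" for u
    by (rule borel_measurable_blinfun_apply_const[OF GX'])
  show ?thesis
  proof (intro exI conjI allI)
    show "G \<in> borel_measurable borel" by (rule G_meas)
    show "operator_L2 M (\<lambda>\<omega>. G (X \<omega>) - h j (X \<omega>))" for j
      using e_int[of j] GX hX by (auto simp: operator_L2_def blinfun.diff_left e_def)
    show "L2norm M (\<lambda>\<omega>. G (X \<omega>) - h j (X \<omega>)) \<le> 2 / 2 ^ j" for j
      unfolding L2norm_def using e_L2[of j] by (intro real_le_lsqrt) (auto simp: e_def)
    have "(\<lambda>\<omega>. norm (G (X \<omega>))) \<in> borel_measurable M"
      by (rule measurable_compose[OF GX']) (intro borel_measurable_continuous_onI continuous_intros)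
    moreover have "(norm (G x))\<^sup>2 \<le> 2 * (e 0 x)\<^sup>2 + 2 * (norm (h 0 x))\<^sup>2" for x
      using norm_add_squared_le[of "G x - h 0 x" "h 0 x"] by (simp add: e_def)
    ultimately have "integrable M (\<lambda>\<omega>. (norm (G (X \<omega>)))\<^sup>2)"
      using e_int[of 0] integrable_norm_squared_simple[OF simple_function_measurable_compose[OF h X, of 0]]
      by (intro Bochner_Integration.integrable_bound[where f="\<lambda>\<omega>. 2 * (e 0 (X \<omega>))\<^sup>2 + 2 * (norm (h 0 (X \<omega>)))\<^sup>2"
         and g="\<lambda>\<omega>. (norm (G (X \<omega>)))\<^sup>2"] Bochner_Integration.integrable_add integrable_mult_right) auto
    then show "operator_L2 M (\<lambda>\<omega>. G (X \<omega>))" using GX by (simp add: operator_L2_def)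
  qed
qed

section \<open>The density of the derivative\<close>

text \<open>The hypothesis on L is an inequality between norms, so a single lemma serves both sums
  and differences of maps.\<close>

lemma tnorm_triangle:
  fixes L K K' :: "('o \<Rightarrow> 'h::real_normed_vector) \<Rightarrow> 'u::real_normed_vector"
  assumes "tnorm M K \<le> ereal a" "tnorm M K' \<le> ereal b"
    and le: "\<And>Y. norm (L Y) \<le> norm (K Y) + norm (K' Y)"
  shows "tnorm M L \<le> ereal (a + b)"
proof (rule tnorm_leI)
  fix n A and x :: "nat \<Rightarrow> 'h"
  assume A: "\<And>i. i < n \<Longrightarrow> A i \<in> sets M" "disjoint_family_on A {..<n}"
    "(\<integral>\<omega>. (norm (\<Sum>i<n. indicator (A i) \<omega> *\<^sub>R x i))\<^sup>2 \<partial>M) \<le> 1"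
  have "(\<Sum>i<n. norm (K (\<lambda>\<omega>. indicator (A i) \<omega> *\<^sub>R x i))) \<le> a"
    using order_trans[OF tnorm_upper[OF A] assms(1)] by (simp only: ereal_less_eq)
  moreover have "(\<Sum>i<n. norm (K' (\<lambda>\<omega>. indicator (A i) \<omega> *\<^sub>R x i))) \<le> b"
    using order_trans[OF tnorm_upper[OF A] assms(2)] by (simp only: ereal_less_eq)
  moreover have "(\<Sum>i<n. norm (L (\<lambda>\<omega>. indicator (A i) \<omega> *\<^sub>R x i)))
      \<le> (\<Sum>i<n. norm (K (\<lambda>\<omega>. indicator (A i) \<omega> *\<^sub>R x i)) + norm (K' (\<lambda>\<omega>. indicator (A i) \<omega> *\<^sub>R x i)))"
    by (intro sum_mono le)
  ultimately show "(\<Sum>i<n. norm (L (\<lambda>\<omega>. indicator (A i) \<omega> *\<^sub>R x i))) \<le> a + b"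
    unfolding sum.distrib by linarith
qed

lemma bounded_linear_L2_minus:
  assumes "bounded_linear_L2 M K" "bounded_linear_L2 M K'"
  shows "bounded_linear_L2 M (\<lambda>Y. K Y - K' Y)"
proof -
  obtain C1 where C1: "\<And>Y. Y \<in> L2 M \<Longrightarrow> norm (K Y) \<le> C1 * L2norm M Y" using bounded_linear_L2_bound[OF assms(1)] by blast
  obtain C2 where C2: "\<And>Y. Y \<in> L2 M \<Longrightarrow> norm (K' Y) \<le> C2 * L2norm M Y" using bounded_linear_L2_bound[OF assms(2)] by blast
  have "norm (K Y - K' Y) \<le> (C1 + C2) * L2norm M Y" if "Y \<in> L2 M" for Y
    using C1[OF that] C2[OF that] norm_triangle_ineq4[of "K Y" "K' Y"] by (simp add: algebra_simps)
  moreover have "K (\<lambda>\<omega>. a *\<^sub>R Y \<omega> + b *\<^sub>R Z \<omega>) - K' (\<lambda>\<omega>. a *\<^sub>R Y \<omega> + b *\<^sub>R Z \<omega>)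
      = a *\<^sub>R (K Y - K' Y) + b *\<^sub>R (K Z - K' Z)" if "Y \<in> L2 M" "Z \<in> L2 M" for Y Z a b
    using assms that unfolding bounded_linear_L2_def by (simp add: algebra_simps)
  ultimately show ?thesis unfolding bounded_linear_L2_def by blast
qed

text \<open>For a unit vector v the single step 1_A v has second moment at most 1 and is a test
  function for \<open>tnorm\<close>. This turns convergence of derivatives in the 2-variation norm
  into convergence on indicators.\<close>

lemma (in prob_space) norm_indicator_le_tnorm:
  assumes L: "bounded_linear_L2 M L" and "tnorm M L \<le> ereal c" and A: "A \<in> sets M"
  shows "norm (L (\<lambda>\<omega>. indicator A \<omega> *\<^sub>R u)) \<le> c * norm u"
proof (cases "u = 0")
  case True
  then show ?thesis using bounded_linear_L2_zero[OF L] by simp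
next
  case False
  define v where "v = u /\<^sub>R norm u"
  have v: "norm v = 1" "u = norm u *\<^sub>R v" using False by (auto simp: v_def)
  have "(\<integral>\<omega>. (norm (\<Sum>i<Suc 0. indicator A \<omega> *\<^sub>R v))\<^sup>2 \<partial>M) = (\<integral>\<omega>. indicator A \<omega> \<partial>M)"
    using v(1) by (intro Bochner_Integration.integral_cong) (auto simp: indicator_def)
  then have "(\<integral>\<omega>. (norm (\<Sum>i<Suc 0. indicator A \<omega> *\<^sub>R v))\<^sup>2 \<partial>M) \<le> 1"
    using A by simp
  from order_trans[OF tnorm_upper[of "Suc 0" "\<lambda>_. A" M "\<lambda>_. v" L, OF _ _ this] assms(2)]
  have "norm (L (\<lambda>\<omega>. indicator A \<omega> *\<^sub>R v)) \<le> c"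
    using A by (auto simp: disjoint_family_on_def)
  moreover have "L (\<lambda>\<omega>. indicator A \<omega> *\<^sub>R u) = norm u *\<^sub>R L (\<lambda>\<omega>. indicator A \<omega> *\<^sub>R v)"
    using bounded_linear_L2_scaleR[OF L L2_indicator[OF A, of v], of "norm u"]
    by (subst v(2)) (simp add: mult.commute)
  ultimately show ?thesis by (simp add: mult.commute[of c] mult_left_mono)
qed

text \<open>The approximants h are part of the conclusion: conditional expectations can be inserted
  directly only under a simple operator-valued function of X.\<close>

lemma (in prob_space) Lambda_C1_density:
  fixes f :: "'h::{banach,second_countable_topology} measure \<Rightarrow> 'u::{banach,second_countable_topology}"
  assumes atomless: "atomless M" and D: "Lambda_C1 M (\<lambda>X. f (distr M borel X)) D" and X: "X \<in> L2 M"
  shows "\<exists>G h. G \<in> borel_measurable borel \<and> operator_L2 M (\<lambda>\<omega>. G (X \<omega>)) \<and>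
    (\<forall>Y\<in>L2 M. D X Y = (\<integral>\<omega>. blinfun_apply (G (X \<omega>)) (Y \<omega>) \<partial>M)) \<and>
    tnorm M (D X) = ereal (L2norm M (\<lambda>\<omega>. G (X \<omega>))) \<and>
    (\<forall>j. simple_function borel (h j) \<and> operator_L2 M (\<lambda>\<omega>. G (X \<omega>) - h j (X \<omega>))) \<and>
    (\<lambda>j. L2norm M (\<lambda>\<omega>. G (X \<omega>) - h j (X \<omega>))) \<longlonglongrightarrow> 0"
proof -
  note Xm[measurable] = L2D(1)[OF X]
  have fre: "frechet_L2 M (\<lambda>X. f (distr M borel X)) X (D X)" "tnorm M (D X) < \<infinity>" if "X \<in> L2 M" for X
    using D that by (auto simp: Lambda_C1_def)
  have bl: "bounded_linear_L2 M (D X)" if "X \<in> L2 M" for X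
    using fre[OF that] by (simp add: frechet_L2_def)
  \<comment> \<open>The identity on H is approximated rather than X itself, so that all approximants
    are fixed simple Borel maps applied to X.\<close>
  have id: "(\<lambda>x::'h. x) \<in> borel_measurable borel" by simp
  obtain T :: "nat \<Rightarrow> 'h \<Rightarrow> 'h" where T: "\<And>n. simple_function borel (T n)" "\<And>x. (\<lambda>n. T n x) \<longlonglongrightarrow> x"
    "\<And>n x. norm (T n x) \<le> 2 * norm x"
    using borel_measurable_implies_sequence_metric[OF id, of 0] unfolding space_borel dist_0_norm norm_conv_dist[symmetric]
    by (metis UNIV_I)
  define Xn where "Xn n \<omega> = T n (X \<omega>)" for n \<omega>
  have Xn_simple: "simple_function M (Xn n)" for n
    unfolding Xn_def by (rule simple_function_measurable_compose[OF T(1) Xm])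
  have Xn_meas: "Xn n \<in> borel_measurable M" for n by (rule borel_measurable_simple_function[OF Xn_simple])
  have Xn: "Xn n \<in> L2 M" "(\<lambda>n. L2norm M (\<lambda>\<omega>. Xn n \<omega> - X \<omega>)) \<longlonglongrightarrow> 0" for n
    using L2norm_tendsto_0[OF X, of Xn, OF Xn_meas] T by (auto simp: Xn_def)
  have dens: "\<exists>k. \<forall>A\<in>sets M. \<forall>u. D (Xn n) (\<lambda>\<omega>. indicator A \<omega> *\<^sub>R u)
      = (\<integral>\<omega>. blinfun_apply (k (Xn n \<omega>)) (indicator A \<omega> *\<^sub>R u) \<partial>M)" for n
  proof -
    have inv: "D (Xn n) (\<lambda>\<omega>. indicator A \<omega> *\<^sub>R u) = D (Xn n) (\<lambda>\<omega>. indicator A' \<omega> *\<^sub>R u)"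
      if "A \<in> sets M" "A' \<in> sets M" "A \<subseteq> Xn n -` {x}" "A' \<subseteq> Xn n -` {x}" "measure M A = measure M A'" for x A A' u
    proof (rule frechet_L2_eq_of_eq_along_lines[OF fre(1)[OF Xn(1)[of n]] fre(1)[OF Xn(1)[of n]] L2_indicator L2_indicator])
      show "f (distr M borel (\<lambda>\<omega>. Xn n \<omega> + t *\<^sub>R (indicator A \<omega> *\<^sub>R u)))
          = f (distr M borel (\<lambda>\<omega>. Xn n \<omega> + t *\<^sub>R (indicator A' \<omega> *\<^sub>R u)))" for t
        unfolding scaleR_left_commute[of t]
        using distr_add_indicator_eq[OF Xn_meas[of n] that(1,3,2,4,5), of "t *\<^sub>R u"] by simp
    qed (use that in auto)
    show ?thesis
      by (rule simple_rearrangement_invariant_density[OF atomless bl[OF Xn(1)[of n]] Xn_simple[of n] inv])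
  qed
  from dens have "\<forall>n. \<exists>k. \<forall>A\<in>sets M. \<forall>u. D (Xn n) (\<lambda>\<omega>. indicator A \<omega> *\<^sub>R u)
      = (\<integral>\<omega>. blinfun_apply (k (Xn n \<omega>)) (indicator A \<omega> *\<^sub>R u) \<partial>M)" by (rule allI)
  from choice[OF this] obtain k where "\<forall>n. \<forall>A\<in>sets M. \<forall>u. D (Xn n) (\<lambda>\<omega>. indicator A \<omega> *\<^sub>R u)
      = (\<integral>\<omega>. blinfun_apply (k n (Xn n \<omega>)) (indicator A \<omega> *\<^sub>R u) \<partial>M)" ..
  then have k: "D (Xn n) (\<lambda>\<omega>. indicator A \<omega> *\<^sub>R u)
      = (\<integral>\<omega>. blinfun_apply (k n (Xn n \<omega>)) (indicator A \<omega> *\<^sub>R u) \<partial>M)" if "A \<in> sets M" for n A u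
    using that by blast
  \<comment> \<open>Continuity of the derivative lets a subsequence converge at the geometric rate
    that \<open>operator_L2_limit_of_simple\<close> requires.\<close>
  have "\<exists>n. tnorm M (\<lambda>Y. D (Xn n) Y - D X Y) \<le> ereal (1 / 2 ^ j)" for j :: nat
  proof -
    have "\<forall>e>0. \<exists>d>0. \<forall>X'\<in>L2 M. L2norm M (\<lambda>\<omega>. X' \<omega> - X \<omega>) < d \<longrightarrow> tnorm M (\<lambda>Y. D X' Y - D X Y) < ereal e"
      using D X unfolding Lambda_C1_def by blast
    moreover have "(0::real) < 1 / 2 ^ j" by simp
    ultimately obtain d where d: "d > 0" "\<forall>X'\<in>L2 M. L2norm M (\<lambda>\<omega>. X' \<omega> - X \<omega>) < d \<longrightarrow>
        tnorm M (\<lambda>Y. D X' Y - D X Y) < ereal (1 / 2 ^ j)" by blast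
    obtain n where "L2norm M (\<lambda>\<omega>. Xn n \<omega> - X \<omega>) < d"
      using order_tendstoD(2)[OF Xn(2) d(1)] by (auto simp: eventually_sequentially)
    then have "tnorm M (\<lambda>Y. D (Xn n) Y - D X Y) < ereal (1 / 2 ^ j)" using d(2) Xn(1) by blast
    then show ?thesis by (intro exI[of _ n] less_imp_le)
  qed
  then obtain r where r: "\<And>j::nat. tnorm M (\<lambda>Y. D (Xn (r j)) Y - D X Y) \<le> ereal (1 / 2 ^ j)" by metis
  define h where "h j x = k (r j) (T (r j) x)" for j x
  have h: "simple_function borel (h j)" for j
    unfolding h_def by (rule simple_function_compose1[OF T(1)])
  have hX: "simple_function M (\<lambda>\<omega>. h j (X \<omega>))" for j by (rule simple_function_measurable_compose[OF h Xm])
  have h_dens: "D (Xn (r j)) (\<lambda>\<omega>. indicator A \<omega> *\<^sub>R u) = (\<integral>\<omega>. h j (X \<omega>) (indicator A \<omega> *\<^sub>R u) \<partial>M)"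
    if "A \<in> sets M" for j A u
    using k[OF that] by (simp add: h_def Xn_def)
  have h_op: "operator_L2 M (\<lambda>\<omega>. h j (X \<omega>))" for j
    unfolding operator_L2_def
    using integrable_norm_squared_simple[OF hX[of j]] borel_measurable_blinfun_apply_const[OF borel_measurable_simple_function[OF hX[of j]]]
    by blast
  \<comment> \<open>The difference of two simple densities is again simple and represents the
    difference of the derivatives, so its L2 norm is at most their 2-variation distance.\<close>
  have cauchy: "L2norm M (\<lambda>\<omega>. h i (X \<omega>) - h j (X \<omega>)) \<le> 1 / 2 ^ i + 1 / 2 ^ j" for i j
  proof -
    let ?L = "\<lambda>Y. D (Xn (r i)) Y - D (Xn (r j)) Y"
    have "ereal (L2norm M (\<lambda>\<omega>. h i (X \<omega>) - h j (X \<omega>))) \<le> tnorm M ?L"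
    proof (rule L2norm_simple_operator_le_tnorm[OF finite_measure_axioms])
      show "simple_function M (\<lambda>\<omega>. h i (X \<omega>) - h j (X \<omega>))" by (rule simple_function_compose2[OF hX hX])
      show "?L (\<lambda>\<omega>. indicator A \<omega> *\<^sub>R u) = (\<integral>\<omega>. (h i (X \<omega>) - h j (X \<omega>)) (indicator A \<omega> *\<^sub>R u) \<partial>M)"
        if "A \<in> sets M" for A u
        unfolding h_dens[OF that] blinfun.diff_left
        by (intro Bochner_Integration.integral_diff[symmetric] operator_L2_integrable[OF h_op] L2_indicator that)
    qed
    also have "\<dots> \<le> ereal (1 / 2 ^ i + 1 / 2 ^ j)"
    proof (rule tnorm_triangle[OF r r])
      show "norm (?L Y) \<le> norm (D (Xn (r i)) Y - D X Y) + norm (D (Xn (r j)) Y - D X Y)" for Y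
        using norm_triangle_ineq4[of "D (Xn (r i)) Y - D X Y" "D (Xn (r j)) Y - D X Y"] by simp
    qed
    finally show ?thesis by (simp only: ereal_less_eq)
  qed
  from operator_L2_limit_of_simple[OF Xm h cauchy]
  obtain G where "G \<in> borel_measurable borel \<and> operator_L2 M (\<lambda>\<omega>. G (X \<omega>)) \<and>
    (\<forall>j. operator_L2 M (\<lambda>\<omega>. G (X \<omega>) - h j (X \<omega>))) \<and>
    (\<forall>j. L2norm M (\<lambda>\<omega>. G (X \<omega>) - h j (X \<omega>)) \<le> 2 / 2 ^ j)" ..
  then have G: "G \<in> borel_measurable borel" "operator_L2 M (\<lambda>\<omega>. G (X \<omega>))"
    "operator_L2 M (\<lambda>\<omega>. G (X \<omega>) - h j (X \<omega>))"
    "L2norm M (\<lambda>\<omega>. G (X \<omega>) - h j (X \<omega>)) \<le> 2 / 2 ^ j" for j by simp_all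
  have pow0: "(\<lambda>j. c / 2 ^ j) \<longlonglongrightarrow> (0::real)" for c
    using tendsto_mult_left[OF LIMSEQ_power_zero[of "1/2::real"], of c] by (simp add: power_one_over)
  \<comment> \<open>The derivatives at the approximants have two limits on an indicator: one by
    convergence in the 2-variation norm, the other by convergence of the densities in L2.\<close>
  have G_ind: "D X (\<lambda>\<omega>. indicator A \<omega> *\<^sub>R u) = (\<integral>\<omega>. G (X \<omega>) (indicator A \<omega> *\<^sub>R u) \<partial>M)" if A: "A \<in> sets M" for A u
  proof (rule LIMSEQ_unique[where X="\<lambda>j. D (Xn (r j)) (\<lambda>\<omega>. indicator A \<omega> *\<^sub>R u)"])
    have "norm (D (Xn (r j)) (\<lambda>\<omega>. indicator A \<omega> *\<^sub>R u) - D X (\<lambda>\<omega>. indicator A \<omega> *\<^sub>R u)) \<le> 1 / 2 ^ j * norm u" for j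
      by (rule norm_indicator_le_tnorm[OF bounded_linear_L2_minus[OF bl[OF Xn(1)] bl[OF X]] r A])
    then have "(\<lambda>j. D (Xn (r j)) (\<lambda>\<omega>. indicator A \<omega> *\<^sub>R u) - D X (\<lambda>\<omega>. indicator A \<omega> *\<^sub>R u)) \<longlonglongrightarrow> 0"
      by (intro Lim_null_comparison[OF always_eventually[OF allI] tendsto_mult_left_zero[OF pow0[of 1], of "norm u"]])
    then show "(\<lambda>j. D (Xn (r j)) (\<lambda>\<omega>. indicator A \<omega> *\<^sub>R u)) \<longlonglongrightarrow> D X (\<lambda>\<omega>. indicator A \<omega> *\<^sub>R u)"
      by (rule LIM_zero_cancel)
    have "norm ((\<integral>\<omega>. G (X \<omega>) (indicator A \<omega> *\<^sub>R u) \<partial>M) - D (Xn (r j)) (\<lambda>\<omega>. indicator A \<omega> *\<^sub>R u))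
        \<le> 2 / 2 ^ j * L2norm M (\<lambda>\<omega>. indicator A \<omega> *\<^sub>R u)" for j
    proof -
      have "(\<integral>\<omega>. G (X \<omega>) (indicator A \<omega> *\<^sub>R u) \<partial>M) - D (Xn (r j)) (\<lambda>\<omega>. indicator A \<omega> *\<^sub>R u)
          = (\<integral>\<omega>. (G (X \<omega>) - h j (X \<omega>)) (indicator A \<omega> *\<^sub>R u) \<partial>M)"
        unfolding h_dens[OF A] blinfun.diff_left
        by (intro Bochner_Integration.integral_diff[symmetric] operator_L2_integrable[OF h_op] operator_L2_integrable[OF G(2)] L2_indicator A)
      also have "norm \<dots> \<le> L2norm M (\<lambda>\<omega>. G (X \<omega>) - h j (X \<omega>)) * L2norm M (\<lambda>\<omega>. indicator A \<omega> *\<^sub>R u)"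
        by (rule operator_L2_norm_integral_le[OF G(3) L2_indicator[OF A]])
      also have "\<dots> \<le> 2 / 2 ^ j * L2norm M (\<lambda>\<omega>. indicator A \<omega> *\<^sub>R u)"
        by (rule mult_right_mono[OF G(4) L2norm_nonneg])
      finally show ?thesis .
    qed
    then have "(\<lambda>j. D (Xn (r j)) (\<lambda>\<omega>. indicator A \<omega> *\<^sub>R u) - (\<integral>\<omega>. G (X \<omega>) (indicator A \<omega> *\<^sub>R u) \<partial>M)) \<longlonglongrightarrow> 0"
      by (intro Lim_null_comparison[OF always_eventually[OF allI] tendsto_mult_left_zero[OF pow0[of 2],
            of "L2norm M (\<lambda>\<omega>. indicator A \<omega> *\<^sub>R u)"]])
         (simp only: norm_minus_commute)
    then show "(\<lambda>j. D (Xn (r j)) (\<lambda>\<omega>. indicator A \<omega> *\<^sub>R u)) \<longlonglongrightarrow> (\<integral>\<omega>. G (X \<omega>) (indicator A \<omega> *\<^sub>R u) \<partial>M)"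
      by (rule LIM_zero_cancel)
  qed
  show ?thesis
  proof (intro exI conjI ballI allI)
    show "D X Y = (\<integral>\<omega>. G (X \<omega>) (Y \<omega>) \<partial>M)" if "Y \<in> L2 M" for Y
      by (rule bounded_linear_L2_eqI[OF finite_measure_axioms bl[OF X] operator_L2_bounded_linear[OF G(2)] G_ind that])
    show "tnorm M (D X) = ereal (L2norm M (\<lambda>\<omega>. G (X \<omega>)))"
    proof (rule antisym)
      show "tnorm M (D X) \<le> ereal (L2norm M (\<lambda>\<omega>. G (X \<omega>)))"
        by (rule tnorm_operator_le[OF finite_measure_axioms G(2) G_ind])
      obtain t where t: "tnorm M (D X) = ereal t"
        using fre(2)[OF X] tnorm_nonneg[of M "D X"] by (cases "tnorm M (D X)") auto
      \<comment> \<open>The lower bound for \<open>tnorm\<close> is available only for simple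
        densities. Replacing G by \<open>h j\<close> costs 2 / 2^j, and replacing the derivative at
        X by the one at the approximant costs 1 / 2^j.\<close>
      have "L2norm M (\<lambda>\<omega>. G (X \<omega>)) \<le> t + 3 / 2 ^ j" for j
      proof -
        note [measurable] = operator_L2_norm_measurable[OF h_op] operator_L2_norm_measurable[OF G(3)]
        have int: "integrable M (\<lambda>\<omega>. (norm (h j (X \<omega>)))\<^sup>2)" "integrable M (\<lambda>\<omega>. (norm (G (X \<omega>) - h j (X \<omega>)))\<^sup>2)"
          "integrable M (\<lambda>\<omega>. (norm (G (X \<omega>)))\<^sup>2)"
          using h_op[of j] G(3)[of j] G(2) by (auto simp: operator_L2_def)
        have int2: "integrable M (\<lambda>\<omega>. (norm (h j (X \<omega>)) + norm (G (X \<omega>) - h j (X \<omega>)))\<^sup>2)"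
          unfolding power2_sum using int
          integrable_mult_of_squares[of "\<lambda>\<omega>. norm (h j (X \<omega>))" M "\<lambda>\<omega>. norm (G (X \<omega>) - h j (X \<omega>))"] by (auto simp: mult.assoc)
        have "L2norm M (\<lambda>\<omega>. G (X \<omega>)) \<le> sqrt (\<integral>\<omega>. (norm (h j (X \<omega>)) + norm (G (X \<omega>) - h j (X \<omega>)))\<^sup>2 \<partial>M)"
          unfolding L2norm_def
        proof (intro real_sqrt_le_mono integral_mono int int2 power_mono norm_ge_zero)
          show "norm (G (X \<omega>)) \<le> norm (h j (X \<omega>)) + norm (G (X \<omega>) - h j (X \<omega>))" for \<omega>
            using norm_triangle_ineq[of "h j (X \<omega>)" "G (X \<omega>) - h j (X \<omega>)"] by simp
        qed
        also have "\<dots> \<le> L2norm M (\<lambda>\<omega>. h j (X \<omega>)) + L2norm M (\<lambda>\<omega>. G (X \<omega>) - h j (X \<omega>))"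
          unfolding L2norm_def by (rule sqrt_integral_add_squared_le) (use int in auto)
        also have "L2norm M (\<lambda>\<omega>. G (X \<omega>) - h j (X \<omega>)) \<le> 2 / 2 ^ j" by (rule G)
        also have "L2norm M (\<lambda>\<omega>. h j (X \<omega>)) \<le> t + 1 / 2 ^ j"
        proof -
          have "ereal (L2norm M (\<lambda>\<omega>. h j (X \<omega>))) \<le> tnorm M (D (Xn (r j)))"
            by (rule L2norm_simple_operator_le_tnorm[OF finite_measure_axioms hX h_dens])
          also have "\<dots> \<le> ereal (t + 1 / 2 ^ j)"
          proof (rule tnorm_triangle[OF eq_refl[OF t] r])
            show "norm (D (Xn (r j)) Y) \<le> norm (D X Y) + norm (D (Xn (r j)) Y - D X Y)" for Y
              using norm_triangle_ineq[of "D X Y" "D (Xn (r j)) Y - D X Y"] by simp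
          qed
          finally show ?thesis by (simp only: ereal_less_eq)
        qed
        finally show ?thesis by (simp add: field_simps)
      qed
      moreover have "(\<lambda>j. t + 3 / 2 ^ j) \<longlonglongrightarrow> t + 0" by (intro tendsto_intros pow0)
      ultimately have "L2norm M (\<lambda>\<omega>. G (X \<omega>)) \<le> t + 0"
        by (intro LIMSEQ_le_const[where X="\<lambda>j. t + 3 / 2 ^ j"]) auto
      then show "ereal (L2norm M (\<lambda>\<omega>. G (X \<omega>))) \<le> tnorm M (D X)" by (simp add: t)
    qed
    show "(\<lambda>j. L2norm M (\<lambda>\<omega>. G (X \<omega>) - h j (X \<omega>))) \<longlonglongrightarrow> 0"
      by (rule tendsto_sandwich[OF _ _ tendsto_const pow0[of 2]]) (auto simp: L2norm_nonneg G(4))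
  qed (fact G h)+
qed

text \<open>The perturbation of X by t u on {X in B} is a function of X alone, so the law of the
  perturbed variable is an image of the law of X and f cannot distinguish X from X' along these
  lines.\<close>

lemma (in prob_space) Lambda_C1_law_invariant:
  fixes f :: "'h::{banach,second_countable_topology} measure \<Rightarrow> 'u::{banach,second_countable_topology}"
  assumes D: "Lambda_C1 M (\<lambda>X. f (distr M borel X)) D" and X: "X \<in> L2 M" and X': "X' \<in> L2 M"
    and eq: "distr M borel X = distr M borel X'" and B: "B \<in> sets borel"
  shows "D X (\<lambda>\<omega>. indicator (X -` B \<inter> space M) \<omega> *\<^sub>R u) = D X' (\<lambda>\<omega>. indicator (X' -` B \<inter> space M) \<omega> *\<^sub>R u)"
proof -
  note [measurable] = L2D(1)[OF X] L2D(1)[OF X'] B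
  have push: "distr M borel (\<lambda>\<omega>. Z \<omega> + t *\<^sub>R (indicator (Z -` B \<inter> space M) \<omega> *\<^sub>R u))
      = distr (distr M borel Z) borel (\<lambda>x. x + t *\<^sub>R (indicator B x *\<^sub>R u))"
    if [measurable]: "Z \<in> borel_measurable M" for Z t
    by (subst distr_distr) (auto intro!: distr_cong simp: indicator_def comp_def)
  have fre: "frechet_L2 M (\<lambda>X. f (distr M borel X)) X (D X)" "frechet_L2 M (\<lambda>X. f (distr M borel X)) X' (D X')"
    using D X X' by (auto simp: Lambda_C1_def)
  show ?thesis
  proof (rule frechet_L2_eq_of_eq_along_lines[OF fre L2_indicator L2_indicator])
    show "f (distr M borel (\<lambda>\<omega>. X \<omega> + t *\<^sub>R (indicator (X -` B \<inter> space M) \<omega> *\<^sub>R u)))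
        = f (distr M borel (\<lambda>\<omega>. X' \<omega> + t *\<^sub>R (indicator (X' -` B \<inter> space M) \<omega> *\<^sub>R u)))" for t
      by (simp only: push[OF L2D(1)[OF X]] push[OF L2D(1)[OF X']] eq)
  qed measurable
qed

section \<open>Conditional expectation in Hilbert space\<close>

text \<open>The property inside the choice operator of \<open>cond_exp_H\<close>, for an arbitrary
  sigma-algebra F.\<close>

definition cond_exp_of :: "'o measure \<Rightarrow> 'o measure \<Rightarrow> ('o \<Rightarrow> 'h::{banach,second_countable_topology}) \<Rightarrow> ('o \<Rightarrow> 'h) \<Rightarrow> bool" where
  "cond_exp_of M F Y Z \<longleftrightarrow> Z \<in> borel_measurable F \<and> integrable M Z \<and>
    (\<forall>A\<in>sets F. (\<integral>\<omega>. indicator A \<omega> *\<^sub>R Z \<omega> \<partial>M) = (\<integral>\<omega>. indicator A \<omega> *\<^sub>R Y \<omega> \<partial>M))"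

text \<open>The inequality can fail only on an open set, which would meet S. It lets almost sure
  statements be tested in countably many directions.\<close>

lemma le_all_of_le_dense:
  fixes z :: "'h::{real_inner,second_countable_topology}"
  assumes "\<And>U. open U \<Longrightarrow> U \<noteq> {} \<Longrightarrow> \<exists>d\<in>S. d \<in> U" and le: "\<And>u. u \<in> S \<Longrightarrow> z \<bullet> u \<le> w * norm u"
  shows "z \<bullet> u \<le> w * norm u"
proof (rule ccontr)
  assume "\<not> z \<bullet> u \<le> w * norm u"
  then have "{u. w * norm u < z \<bullet> u} \<noteq> {}" by (auto simp: not_le)
  moreover have "open {u. w * norm u < z \<bullet> u}" by (intro open_Collect_less continuous_intros)
  ultimately obtain d where "d \<in> S" "w * norm d < z \<bullet> d" using assms(1) by blast
  then show False using le[of d] by simp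
qed

context finite_measure_subalgebra
begin

lemma subalg_sets: "A \<in> sets F \<Longrightarrow> A \<in> sets M"
  using subalg by (auto simp: subalgebra_def)

text \<open>For a fixed u the inner product of Z with u is a scalar conditional expectation, bounded
  by that of \<open>norm (Y _)\<close> times the norm of u. Countably many u produce one null set,
  and density allows u to depend on the sample point.\<close>

lemma cond_exp_of_norm_le:
  fixes Y :: "'a \<Rightarrow> 'h::{real_inner,banach,second_countable_topology}"
  assumes Y: "integrable M Y" and Z: "cond_exp_of M F Y Z"
  shows "AE \<omega> in M. norm (Z \<omega>) \<le> real_cond_exp M F (\<lambda>\<omega>. norm (Y \<omega>)) \<omega>"
proof -
  obtain S :: "'h set" where S: "countable S" "\<And>U. open U \<Longrightarrow> U \<noteq> {} \<Longrightarrow> \<exists>d\<in>S. d \<in> U"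
    by (rule countable_dense_setE) blast
  let ?W = "real_cond_exp M F (\<lambda>\<omega>. norm (Y \<omega>))"
  have ZF[measurable]: "Z \<in> borel_measurable F" and Zint: "integrable M Z" using Z by (auto simp: cond_exp_of_def)
  have "AE \<omega> in M. Z \<omega> \<bullet> u \<le> ?W \<omega> * norm u" for u
  proof -
    have 1: "AE \<omega> in M. real_cond_exp M F (\<lambda>\<omega>. Y \<omega> \<bullet> u) \<omega> = Z \<omega> \<bullet> u"
    proof (rule real_cond_exp_charact)
      fix A assume A: "A \<in> sets F"
      have "(\<integral>\<omega>\<in>A. Y \<omega> \<bullet> u \<partial>M) = (\<integral>\<omega>. (indicator A \<omega> *\<^sub>R Y \<omega>) \<bullet> u \<partial>M)"
        by (simp add: set_lebesgue_integral_def)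
      also have "\<dots> = (\<integral>\<omega>. indicator A \<omega> *\<^sub>R Y \<omega> \<partial>M) \<bullet> u"
        by (intro integral_inner_left integrable_mult_indicator subalg_sets A Y)
      also have "\<dots> = (\<integral>\<omega>. indicator A \<omega> *\<^sub>R Z \<omega> \<partial>M) \<bullet> u"
        using Z A by (simp add: cond_exp_of_def)
      also have "\<dots> = (\<integral>\<omega>. (indicator A \<omega> *\<^sub>R Z \<omega>) \<bullet> u \<partial>M)"
        by (intro integral_inner_left[symmetric] integrable_mult_indicator subalg_sets A Zint)
      also have "\<dots> = (\<integral>\<omega>\<in>A. Z \<omega> \<bullet> u \<partial>M)"
        by (simp add: set_lebesgue_integral_def)
      finally show "(\<integral>\<omega>\<in>A. Y \<omega> \<bullet> u \<partial>M) = (\<integral>\<omega>\<in>A. Z \<omega> \<bullet> u \<partial>M)" .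
    qed (use Y Zint in auto)
    have 2: "AE \<omega> in M. real_cond_exp M F (\<lambda>\<omega>. Y \<omega> \<bullet> u) \<omega> \<le> real_cond_exp M F (\<lambda>\<omega>. norm u * norm (Y \<omega>)) \<omega>"
      using Y by (intro real_cond_exp_mono) (auto intro!: AE_I2 simp: norm_cauchy_schwarz mult.commute[of "norm u"])
    have 3: "AE \<omega> in M. real_cond_exp M F (\<lambda>\<omega>. norm u * norm (Y \<omega>)) \<omega> = norm u * ?W \<omega>"
      using Y by (intro real_cond_exp_cmult) auto
    show ?thesis using 1 2 3 by eventually_elim (simp add: mult.commute)
  qed
  then have "AE \<omega> in M. \<forall>u\<in>S. Z \<omega> \<bullet> u \<le> ?W \<omega> * norm u"
    using S(1) by (subst AE_ball_countable) auto
  moreover have "AE \<omega> in M. 0 \<le> ?W \<omega>" using Y by (intro real_cond_exp_pos) auto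
  ultimately show ?thesis
  proof eventually_elim
    case (elim \<omega>)
    \<comment> \<open>The direction is Z itself. Cancelling its norm gives the claim, with
      nonnegativity of \<open>?W\<close> covering Z = 0.\<close>
    have "Z \<omega> \<bullet> Z \<omega> \<le> ?W \<omega> * norm (Z \<omega>)"
      by (rule le_all_of_le_dense[of S]) (use S(2) elim in blast)+
    then have "norm (Z \<omega>) * norm (Z \<omega>) \<le> ?W \<omega> * norm (Z \<omega>)"
      by (simp add: power2_norm_eq_inner[symmetric] power2_eq_square)
    then show ?case using elim by (cases "Z \<omega> = 0") auto
  qed
qed

lemma cond_exp_of_diff:
  assumes "integrable M Y" "integrable M Y'" "cond_exp_of M F Y Z" "cond_exp_of M F Y' Z'"
  shows "cond_exp_of M F (\<lambda>\<omega>. Y \<omega> - Y' \<omega>) (\<lambda>\<omega>. Z \<omega> - Z' \<omega>)"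
  using assms unfolding cond_exp_of_def
  by (auto simp: scaleR_diff_right integrable_mult_indicator subalg_sets)

text \<open>Indicators reduce to scalar conditional expectation. In the limit case
  \<open>cond_exp_of_norm_le\<close> makes conditioning an L1 contraction, so the conditional
  expectations of the approximants are Cauchy in L1 and a subsequence converges almost
  surely.\<close>

lemma cond_exp_of_ex:
  fixes Y :: "'a \<Rightarrow> 'h::{real_inner,banach,second_countable_topology}"
  assumes "integrable M Y"
  shows "\<exists>Z. cond_exp_of M F Y Z"
  using assms
proof (induction rule: integrable_induct)
  case (base A c)
  let ?p = "real_cond_exp M F (indicator A)"
  have ind: "integrable M (indicator A :: 'a \<Rightarrow> real)" using base by simp
  then have p: "integrable M ?p" by (rule real_cond_exp_int)
  have "cond_exp_of M F (\<lambda>\<omega>. indicator A \<omega> *\<^sub>R c) (\<lambda>\<omega>. ?p \<omega> *\<^sub>R c)"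
    unfolding cond_exp_of_def
  proof (intro conjI ballI)
    fix B assume B: "B \<in> sets F"
    have "(\<integral>\<omega>. indicator B \<omega> *\<^sub>R (?p \<omega> *\<^sub>R c) \<partial>M) = (\<integral>\<omega>. (indicator B \<omega> *\<^sub>R ?p \<omega>) *\<^sub>R c \<partial>M)" by simp
    also have "\<dots> = (\<integral>\<omega>. indicator B \<omega> *\<^sub>R ?p \<omega> \<partial>M) *\<^sub>R c"
      by (intro integral_scaleR_left integrable_mult_indicator subalg_sets B p)
    also have "(\<integral>\<omega>. indicator B \<omega> *\<^sub>R ?p \<omega> \<partial>M) = (\<integral>\<omega>. indicator B \<omega> *\<^sub>R indicator A \<omega> \<partial>M)"
      using real_cond_exp_intA[OF ind B] by (simp add: set_lebesgue_integral_def)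
    also have "\<dots> *\<^sub>R c = (\<integral>\<omega>. (indicator B \<omega> *\<^sub>R indicator A \<omega>) *\<^sub>R c \<partial>M)"
      by (intro integral_scaleR_left[symmetric] integrable_mult_indicator subalg_sets B ind)
    finally show "(\<integral>\<omega>. indicator B \<omega> *\<^sub>R (?p \<omega> *\<^sub>R c) \<partial>M) = (\<integral>\<omega>. indicator B \<omega> *\<^sub>R (indicator A \<omega> *\<^sub>R c) \<partial>M)"
      by simp
  qed (use p in auto)
  then show ?case by blast
next
  case (add Y Y')
  then obtain Z Z' where "cond_exp_of M F Y Z" "cond_exp_of M F Y' Z'" by blast
  then have "cond_exp_of M F (\<lambda>\<omega>. Y \<omega> + Y' \<omega>) (\<lambda>\<omega>. Z \<omega> + Z' \<omega>)"
    using add.hyps unfolding cond_exp_of_def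
    by (auto simp: scaleR_add_right integrable_mult_indicator subalg_sets)
  then show ?case by blast
next
  case (lim Y s)
  from lim.IH have "\<forall>i. \<exists>Z. cond_exp_of M F (s i) Z" by (rule allI)
  from choice[OF this] obtain Z where Z: "\<And>i. cond_exp_of M F (s i) (Z i)" by blast
  have ZF[measurable]: "Z i \<in> borel_measurable F" and Zint: "integrable M (Z i)" for i
    using Z[of i] by (auto simp: cond_exp_of_def)
  \<comment> \<open>The factor 2 is that of the domination of the approximants by
    \<open>2 * norm (Y _)\<close> in the induction rule; \<open>?W\<close> dominates all
    \<open>Z i\<close> at once.\<close>
  let ?W = "real_cond_exp M F (\<lambda>\<omega>. 2 * norm (Y \<omega>))"
  note [measurable] = borel_measurable_integrable[OF lim.hyps(1)] borel_measurable_integrable[OF lim.hyps(4)]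
  have Y2: "integrable M (\<lambda>\<omega>. 2 * norm (Y \<omega>))" using lim.hyps(4) by auto
  have Wint: "integrable M ?W" by (rule real_cond_exp_int(1)[OF Y2])
  have dom: "AE \<omega> in M. norm (Z i \<omega>) \<le> ?W \<omega>" for i
  proof -
    have "AE \<omega> in M. real_cond_exp M F (\<lambda>\<omega>. norm (s i \<omega>)) \<omega> \<le> ?W \<omega>"
      using lim.hyps Y2 by (intro real_cond_exp_mono) auto
    with cond_exp_of_norm_le[OF lim.hyps(1)[of i] Z[of i]] show ?thesis by eventually_elim simp
  qed
  have s0: "(\<lambda>i. \<integral>\<omega>. norm (s i \<omega> - Y \<omega>) \<partial>M) \<longlonglongrightarrow> 0"
  proof -
    have "(\<lambda>i. \<integral>\<omega>. norm (s i \<omega> - Y \<omega>) \<partial>M) \<longlonglongrightarrow> (\<integral>\<omega>. 0 \<partial>M)"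
    proof (rule integral_dominated_convergence[where w="\<lambda>\<omega>. 3 * norm (Y \<omega>)"])
      show "AE \<omega> in M. (\<lambda>i. norm (s i \<omega> - Y \<omega>)) \<longlonglongrightarrow> 0"
        by (rule AE_I2) (use lim.hyps(2) in \<open>simp add: LIM_zero tendsto_norm_zero\<close>)
      show "AE \<omega> in M. norm (norm (s i \<omega> - Y \<omega>)) \<le> 3 * norm (Y \<omega>)" for i
      proof (rule AE_I2)
        fix \<omega> assume "\<omega> \<in> space M"
        then show "norm (norm (s i \<omega> - Y \<omega>)) \<le> 3 * norm (Y \<omega>)"
          using lim.hyps(3)[of \<omega> i] norm_triangle_ineq4[of "s i \<omega>" "Y \<omega>"] by simp
      qed
    qed (use lim.hyps(4) in auto)
    then show ?thesis by simp
  qed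
  have diff: "(\<integral>\<omega>. norm (Z i \<omega> - Z j \<omega>) \<partial>M) \<le> (\<integral>\<omega>. norm (s i \<omega> - Y \<omega>) \<partial>M) + (\<integral>\<omega>. norm (s j \<omega> - Y \<omega>) \<partial>M)" for i j
  proof -
    have sij: "integrable M (\<lambda>\<omega>. norm (s i \<omega> - s j \<omega>))" using lim.hyps(1) by auto
    have "(\<integral>\<omega>. norm (Z i \<omega> - Z j \<omega>) \<partial>M) \<le> (\<integral>\<omega>. real_cond_exp M F (\<lambda>\<omega>. norm (s i \<omega> - s j \<omega>)) \<omega> \<partial>M)"
      using Zint real_cond_exp_int(1)[OF sij]
        cond_exp_of_norm_le[OF _ cond_exp_of_diff[OF lim.hyps(1)[of i] lim.hyps(1)[of j] Z[of i] Z[of j]]] lim.hyps(1)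
      by (intro integral_mono_AE) auto
    also have "\<dots> = (\<integral>\<omega>. norm (s i \<omega> - s j \<omega>) \<partial>M)" by (rule real_cond_exp_int(2)[OF sij])
    also have "\<dots> \<le> (\<integral>\<omega>. norm (s i \<omega> - Y \<omega>) + norm (s j \<omega> - Y \<omega>) \<partial>M)"
    proof (rule integral_mono[OF sij])
      show "norm (s i \<omega> - s j \<omega>) \<le> norm (s i \<omega> - Y \<omega>) + norm (s j \<omega> - Y \<omega>)" for \<omega>
        using norm_triangle_ineq4[of "s i \<omega> - Y \<omega>" "s j \<omega> - Y \<omega>"] by simp
    qed (use lim.hyps in auto)
    also have "\<dots> = (\<integral>\<omega>. norm (s i \<omega> - Y \<omega>) \<partial>M) + (\<integral>\<omega>. norm (s j \<omega> - Y \<omega>) \<partial>M)"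
      using lim.hyps by (intro Bochner_Integration.integral_add) auto
    finally show ?thesis .
  qed
  have "\<exists>N. \<forall>i\<ge>N. \<forall>j\<ge>N. (\<integral>\<omega>. norm (Z i \<omega> - Z j \<omega>) \<partial>M) < e" if "e > 0" for e
  proof -
    obtain N where N: "\<And>i. i \<ge> N \<Longrightarrow> (\<integral>\<omega>. norm (s i \<omega> - Y \<omega>) \<partial>M) < e / 2"
      using order_tendstoD(2)[OF s0, of "e / 2"] \<open>e > 0\<close> by (auto simp: eventually_sequentially)
    have "(\<integral>\<omega>. norm (Z i \<omega> - Z j \<omega>) \<partial>M) < e" if "i \<ge> N" "j \<ge> N" for i j
      using diff[of i j] N[OF that(1)] N[OF that(2)] by linarith
    then show ?thesis by blast
  qed
  then obtain r where r: "strict_mono r" "AE \<omega> in M. Cauchy (\<lambda>i. Z (r i) \<omega>)"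
    using cauchy_L1_AE_cauchy_subseq[where M=M and s=Z, OF Zint] by blast
  \<comment> \<open>Defined by \<open>lim\<close> everywhere, so that V is measurable for F itself,
    although convergence is known only almost surely.\<close>
  define V where "V \<omega> = lim (\<lambda>i. Z (r i) \<omega>)" for \<omega>
  have VF: "V \<in> borel_measurable F" unfolding V_def by measurable
  have VM[measurable]: "V \<in> borel_measurable M" by (rule measurable_from_subalg[OF subalg VF])
  have Vlim: "AE \<omega> in M. (\<lambda>i. Z (r i) \<omega>) \<longlonglongrightarrow> V \<omega>"
    using r(2) by eventually_elim (simp add: V_def Cauchy_convergent convergent_LIMSEQ_iff[symmetric])
  note Zm = borel_measurable_integrable[OF Zint]
  have Vint: "integrable M V"
    by (rule integrable_dominated_convergence[OF VM Zm Wint Vlim dom])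
  have "cond_exp_of M F Y V"
    unfolding cond_exp_of_def
  proof (intro conjI ballI VF Vint)
    fix A assume A: "A \<in> sets F"
    note [measurable] = subalg_sets[OF A] Zm
    have "(\<lambda>i. \<integral>\<omega>. indicator A \<omega> *\<^sub>R Z (r i) \<omega> \<partial>M) \<longlonglongrightarrow> (\<integral>\<omega>. indicator A \<omega> *\<^sub>R V \<omega> \<partial>M)"
    proof (rule integral_dominated_convergence[OF _ _ Wint])
      show "AE \<omega> in M. (\<lambda>i. indicator A \<omega> *\<^sub>R Z (r i) \<omega>) \<longlonglongrightarrow> indicator A \<omega> *\<^sub>R V \<omega>"
        using Vlim by eventually_elim (intro tendsto_intros)
      show "AE \<omega> in M. norm (indicator A \<omega> *\<^sub>R Z (r i) \<omega>) \<le> ?W \<omega>" for i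
        using dom[of "r i"]
      proof eventually_elim
        case (elim \<omega>)
        then show ?case using order_trans[OF norm_ge_zero elim] by (simp add: indicator_def)
      qed
    qed measurable
    moreover have "(\<lambda>i. \<integral>\<omega>. indicator A \<omega> *\<^sub>R s (r i) \<omega> \<partial>M) \<longlonglongrightarrow> (\<integral>\<omega>. indicator A \<omega> *\<^sub>R Y \<omega> \<partial>M)"
    proof (rule integral_dominated_convergence[OF _ _ Y2])
      show "AE \<omega> in M. (\<lambda>i. indicator A \<omega> *\<^sub>R s (r i) \<omega>) \<longlonglongrightarrow> indicator A \<omega> *\<^sub>R Y \<omega>"
      proof (rule AE_I2)
        fix \<omega> assume "\<omega> \<in> space M"
        then show "(\<lambda>i. indicator A \<omega> *\<^sub>R s (r i) \<omega>) \<longlonglongrightarrow> indicator A \<omega> *\<^sub>R Y \<omega>"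
          using LIMSEQ_subseq_LIMSEQ[OF lim.hyps(2) r(1)] by (intro tendsto_intros) (simp add: comp_def)
      qed
      show "AE \<omega> in M. norm (indicator A \<omega> *\<^sub>R s (r i) \<omega>) \<le> 2 * norm (Y \<omega>)" for i
        by (rule AE_I2) (use lim.hyps(3) in \<open>auto simp: indicator_def\<close>)
    qed measurable
    moreover have "(\<integral>\<omega>. indicator A \<omega> *\<^sub>R Z (r i) \<omega> \<partial>M) = (\<integral>\<omega>. indicator A \<omega> *\<^sub>R s (r i) \<omega> \<partial>M)" for i
      using Z[of "r i"] A by (simp add: cond_exp_of_def)
    ultimately show "(\<integral>\<omega>. indicator A \<omega> *\<^sub>R V \<omega> \<partial>M) = (\<integral>\<omega>. indicator A \<omega> *\<^sub>R Y \<omega> \<partial>M)"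
      by (simp only: LIMSEQ_unique)
  qed
  then show ?case by blast
qed

text \<open>Jensen's inequality for the square is needed only for the scalar majorant of Z.\<close>

lemma cond_exp_of_L2:
  fixes Y :: "'a \<Rightarrow> 'h::{real_inner,banach,second_countable_topology}"
  assumes Y: "Y \<in> L2 M" "integrable M Y" and Z: "cond_exp_of M F Y Z"
  shows "Z \<in> L2 M"
proof -
  let ?W = "real_cond_exp M F (\<lambda>\<omega>. norm (Y \<omega>))"
  have Zm[measurable]: "Z \<in> borel_measurable M" using Z by (auto simp: cond_exp_of_def)
  have W2: "integrable M (\<lambda>\<omega>. (?W \<omega>)\<^sup>2)"
    by (rule integrable_convex_cond_exp[where I=UNIV and q="\<lambda>x. x\<^sup>2"])
       (use Y L2D(2)[OF Y(1)] in \<open>auto simp: finite_emeasure_space convex_power2\<close>)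
  have "integrable M (\<lambda>\<omega>. (norm (Z \<omega>))\<^sup>2)"
  proof (rule Bochner_Integration.integrable_bound[OF W2])
    show "AE \<omega> in M. norm ((norm (Z \<omega>))\<^sup>2) \<le> norm ((?W \<omega>)\<^sup>2)"
      using cond_exp_of_norm_le[OF Y(2) Z] by eventually_elim (auto intro!: power_mono)
  qed measurable
  then show ?thesis using Zm by (simp add: L2_def)
qed

end

section \<open>Conditioning on X\<close>

lemma (in prob_space) cond_exp_H_correct:
  fixes Y :: "'a \<Rightarrow> 'h::{real_inner,banach,second_countable_topology}"
  assumes X: "X \<in> borel_measurable M" and Y: "Y \<in> L2 M"
  shows "cond_exp_of M (vimage_algebra (space M) X borel) Y (cond_exp_H M X Y)" "cond_exp_H M X Y \<in> L2 M"
proof -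
  interpret S: finite_measure_subalgebra M "vimage_algebra (space M) X borel"
  proof
    show "subalgebra M (vimage_algebra (space M) X borel)"
      using X by (auto simp: subalgebra_def sets_vimage_algebra2 intro!: measurable_sets)
  qed
  have Yint: "integrable M Y" by (rule L2_integrable[OF Y])
  show 1: "cond_exp_of M (vimage_algebra (space M) X borel) Y (cond_exp_H M X Y)"
    using someI_ex[OF S.cond_exp_of_ex[OF Yint]] unfolding cond_exp_H_def cond_exp_of_def .
  show "cond_exp_H M X Y \<in> L2 M" by (rule S.cond_exp_of_L2[OF Y Yint 1])
qed

text \<open>On each event {X in B i}, which belongs to the sigma-algebra of X, the operator is
  constant and commutes with the integral.\<close>

lemma (in prob_space) integral_simple_operator_cond_exp:
  fixes Y :: "'a \<Rightarrow> 'h::{banach,second_countable_topology}"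
    and h :: "'b::topological_space \<Rightarrow> 'h \<Rightarrow>\<^sub>L 'u::{banach,second_countable_topology}"
  assumes X: "X \<in> borel_measurable M" and h: "simple_function borel h" and Y: "integrable M Y"
    and Z: "cond_exp_of M (vimage_algebra (space M) X borel) Y Z"
  shows "(\<integral>\<omega>. h (X \<omega>) (Z \<omega>) \<partial>M) = (\<integral>\<omega>. h (X \<omega>) (Y \<omega>) \<partial>M)"
proof -
  have Zint: "integrable M Z" using Z by (simp add: cond_exp_of_def)
  obtain n :: nat and B t where *: "\<forall>i<n. B i \<in> sets borel"
    "\<forall>x\<in>space borel. h x = (\<Sum>i<n. indicator (B i) x *\<^sub>R t i)"
    using simple_function_step_representation[OF h] by blast
  define A where "A i = X -` B i \<inter> space M" for i
  have A: "A i \<in> sets M" "A i \<in> sets (vimage_algebra (space M) X borel)" if "i < n" for i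
    unfolding A_def using *(1) that by (auto intro!: measurable_sets[OF X] in_vimage_algebra)
  have expand: "(\<integral>\<omega>. h (X \<omega>) (V \<omega>) \<partial>M) = (\<Sum>i<n. t i (\<integral>\<omega>. indicator (A i) \<omega> *\<^sub>R V \<omega> \<partial>M))"
    if V: "integrable M V" for V
  proof -
    have int: "integrable M (\<lambda>\<omega>. indicator (A i) \<omega> *\<^sub>R V \<omega>)" if "i < n" for i
      by (rule integrable_mult_indicator[OF A(1)[OF that] V])
    have "(\<integral>\<omega>. h (X \<omega>) (V \<omega>) \<partial>M) = (\<integral>\<omega>. (\<Sum>i<n. t i (indicator (A i) \<omega> *\<^sub>R V \<omega>)) \<partial>M)"
    proof (rule Bochner_Integration.integral_cong[OF refl])
      fix \<omega> assume \<omega>: "\<omega> \<in> space M"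
      have "h (X \<omega>) = (\<Sum>i<n. indicator (B i) (X \<omega>) *\<^sub>R t i)" using *(2) by simp
      then have "h (X \<omega>) (V \<omega>) = (\<Sum>i<n. indicator (B i) (X \<omega>) *\<^sub>R t i (V \<omega>))"
        by (simp only: blinfun.sum_left blinfun.scaleR_left)
      also have "\<dots> = (\<Sum>i<n. t i (indicator (A i) \<omega> *\<^sub>R V \<omega>))"
        using \<omega> by (intro sum.cong) (auto simp: A_def indicator_def)
      finally show "h (X \<omega>) (V \<omega>) = (\<Sum>i<n. t i (indicator (A i) \<omega> *\<^sub>R V \<omega>))" .
    qed
    also have "\<dots> = (\<Sum>i<n. \<integral>\<omega>. t i (indicator (A i) \<omega> *\<^sub>R V \<omega>) \<partial>M)"
      using int by (intro Bochner_Integration.integral_sum integrable_bounded_linear[OF blinfun.bounded_linear_right]) auto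
    also have "\<dots> = (\<Sum>i<n. t i (\<integral>\<omega>. indicator (A i) \<omega> *\<^sub>R V \<omega> \<partial>M))"
      using int by (intro sum.cong refl integral_bounded_linear[OF blinfun.bounded_linear_right]) auto
    finally show ?thesis .
  qed
  have "(\<Sum>i<n. t i (\<integral>\<omega>. indicator (A i) \<omega> *\<^sub>R Z \<omega> \<partial>M)) = (\<Sum>i<n. t i (\<integral>\<omega>. indicator (A i) \<omega> *\<^sub>R Y \<omega> \<partial>M))"
    using A(2) Z by (intro sum.cong) (auto simp: cond_exp_of_def)
  then show ?thesis unfolding expand[OF Y] expand[OF Zint] .
qed

section \<open>The Radon-Nikodym derivative\<close>

text \<open>For each u the vector densities \<open>G x u\<close> and \<open>G' x u\<close> agree
  almost everywhere. A countable dense set of u leaves one null set, and continuity of the operators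
  extends equality to all u.\<close>

lemma operator_density_unique:
  fixes G G' :: "'h::{banach,second_countable_topology} \<Rightarrow> 'h \<Rightarrow>\<^sub>L 'u::{banach,second_countable_topology}"
  assumes "finite_measure \<mu>" and \<mu>: "sets \<mu> = sets borel"
    and G: "G \<in> borel_measurable borel" "integrable \<mu> (\<lambda>x. (norm (G x))\<^sup>2)"
    and G': "G' \<in> borel_measurable borel" "integrable \<mu> (\<lambda>x. (norm (G' x))\<^sup>2)"
    and eq: "\<And>B u. B \<in> sets borel \<Longrightarrow> (\<integral>x. indicator B x *\<^sub>R G x u \<partial>\<mu>) = (\<integral>x. indicator B x *\<^sub>R G' x u \<partial>\<mu>)"
  shows "AE x in \<mu>. G x = G' x"
proof -
  interpret finite_measure \<mu> by fact
  have int: "integrable \<mu> (\<lambda>x. G x u)"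
    if G: "G \<in> borel_measurable borel" "integrable \<mu> (\<lambda>x. (norm (G x))\<^sup>2)"
    for u and G :: "'h \<Rightarrow> 'h \<Rightarrow>\<^sub>L 'u"
  proof -
    have "(\<lambda>x. G x u) \<in> borel_measurable \<mu>" for u
      using borel_measurable_blinfun_apply_const[OF G(1)] measurable_cong_sets[OF \<mu> refl] by blast
    then have op: "operator_L2 \<mu> G" using G(2) by (auto simp: operator_L2_def)
    \<comment> \<open>The constant vector u is written as an indicator on the whole space to apply
      the estimates for \<open>L2\<close>.\<close>
    have "integrable \<mu> (\<lambda>x. G x (indicator (space \<mu>) x *\<^sub>R u))"
      by (rule operator_L2_integrable[OF op L2_indicator]) simp
    then show ?thesis by (rule Bochner_Integration.integrable_cong[THEN iffD1, rotated -1]) auto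
  qed
  obtain S :: "'h set" where S: "countable S" "\<And>U. open U \<Longrightarrow> U \<noteq> {} \<Longrightarrow> \<exists>d\<in>S. d \<in> U"
    by (rule countable_dense_setE) blast
  have "AE x in \<mu>. G x u = G' x u" for u
    by (rule density_unique_banach[OF int[OF G] int[OF G']])
       (use eq \<mu> in \<open>simp add: set_lebesgue_integral_def\<close>)
  then have "AE x in \<mu>. \<forall>u\<in>S. G x u = G' x u"
    using S(1) by (subst AE_ball_countable) auto
  then show ?thesis
  proof eventually_elim
    case (elim x)
    show ?case
    proof (rule blinfun_eqI, rule ccontr)
      fix u assume "G x u \<noteq> G' x u"
      then have "{u. G x u \<noteq> G' x u} \<noteq> {}" by auto
      moreover have "open {u. G x u \<noteq> G' x u}" by (intro open_Collect_neq continuous_intros)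
      ultimately show False using S(2) elim by blast
    qed
  qed
qed

text \<open>The identity holds for each \<open>h j\<close>, and the pairing with a fixed element of
  \<open>L2\<close> is continuous in the density.\<close>

lemma (in prob_space) integral_operator_cond_exp_H:
  fixes Y :: "'a \<Rightarrow> 'h::{real_inner,banach,second_countable_topology}"
    and G :: "'b::{banach,second_countable_topology} \<Rightarrow> 'h \<Rightarrow>\<^sub>L 'u::{banach,second_countable_topology}"
  assumes X: "X \<in> borel_measurable M" and Y: "Y \<in> L2 M" and Z: "Z \<in> L2 M" "cond_exp_of M (vimage_algebra (space M) X borel) Y Z"
    and G: "operator_L2 M (\<lambda>\<omega>. G (X \<omega>))" and h: "\<And>j. simple_function borel (h j)"
    and diff: "\<And>j. operator_L2 M (\<lambda>\<omega>. G (X \<omega>) - h j (X \<omega>))"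
    and lim: "(\<lambda>j. L2norm M (\<lambda>\<omega>. G (X \<omega>) - h j (X \<omega>))) \<longlonglongrightarrow> 0"
  shows "(\<integral>\<omega>. G (X \<omega>) (Z \<omega>) \<partial>M) = (\<integral>\<omega>. G (X \<omega>) (Y \<omega>) \<partial>M)"
proof -
  have conv: "(\<lambda>j. \<integral>\<omega>. h j (X \<omega>) (V \<omega>) \<partial>M) \<longlonglongrightarrow> (\<integral>\<omega>. G (X \<omega>) (V \<omega>) \<partial>M)" if V: "V \<in> L2 M" for V :: "'a \<Rightarrow> 'h"
  proof -
    have "(\<integral>\<omega>. G (X \<omega>) (V \<omega>) \<partial>M) - (\<integral>\<omega>. (G (X \<omega>) - h j (X \<omega>)) (V \<omega>) \<partial>M) = (\<integral>\<omega>. h j (X \<omega>) (V \<omega>) \<partial>M)" for j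
      using Bochner_Integration.integral_diff[OF operator_L2_integrable[OF G V] operator_L2_integrable[OF diff V], of j]
      by (simp add: blinfun.diff_left)
    moreover have "(\<lambda>j. \<integral>\<omega>. (G (X \<omega>) - h j (X \<omega>)) (V \<omega>) \<partial>M) \<longlonglongrightarrow> 0"
      by (rule Lim_null_comparison[OF always_eventually[OF allI] tendsto_mult_left_zero[OF lim, of "L2norm M V"]])
         (rule operator_L2_norm_integral_le[OF diff V])
    then have "(\<lambda>j. (\<integral>\<omega>. G (X \<omega>) (V \<omega>) \<partial>M) - (\<integral>\<omega>. (G (X \<omega>) - h j (X \<omega>)) (V \<omega>) \<partial>M))
        \<longlonglongrightarrow> (\<integral>\<omega>. G (X \<omega>) (V \<omega>) \<partial>M) - 0"
      by (intro tendsto_diff tendsto_const)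
    ultimately show ?thesis by simp
  qed
  show ?thesis
    using LIMSEQ_unique[OF conv[OF Z(1)]] conv[OF Y]
    by (simp add: integral_simple_operator_cond_exp[OF X h L2_integrable[OF Y] Z(2)])
qed

lemma (in prob_space) derivative_measure_density:
  fixes G :: "'h::{banach,second_countable_topology} \<Rightarrow> 'h \<Rightarrow>\<^sub>L 'u::{banach,second_countable_topology}"
  assumes X: "X \<in> borel_measurable M" and G: "G \<in> borel_measurable borel"
    and L: "\<And>Y. Y \<in> L2 M \<Longrightarrow> L Y = (\<integral>\<omega>. G (X \<omega>) (Y \<omega>) \<partial>M)" and B: "B \<in> sets borel"
  shows "L (\<lambda>\<omega>. indicator (X -` B \<inter> space M) \<omega> *\<^sub>R u) = (\<integral>x. indicator B x *\<^sub>R G x u \<partial>distr M borel X)"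
proof -
  note [measurable] = borel_measurable_blinfun_apply_const[OF G] B X
  have "L (\<lambda>\<omega>. indicator (X -` B \<inter> space M) \<omega> *\<^sub>R u) = (\<integral>\<omega>. G (X \<omega>) (indicator (X -` B \<inter> space M) \<omega> *\<^sub>R u) \<partial>M)"
    by (intro L L2_indicator) measurable
  also have "\<dots> = (\<integral>\<omega>. indicator B (X \<omega>) *\<^sub>R G (X \<omega>) u \<partial>M)"
    by (intro Bochner_Integration.integral_cong refl) (auto simp: indicator_def)
  also have "\<dots> = (\<integral>x. indicator B x *\<^sub>R G x u \<partial>distr M borel X)"
    by (rule integral_distr[symmetric]) measurable
  finally show ?thesis .
qed

theorem theorem1p4:
  fixes M :: "'o::polish_space measure"
    and f :: "'h::{real_inner,banach,second_countable_topology} measure \<Rightarrow> 'u::{real_inner,banach,second_countable_topology}"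
    and D :: "('o \<Rightarrow> 'h) \<Rightarrow> ('o \<Rightarrow> 'h) \<Rightarrow> 'u"
  assumes "prob_space M"
    and "\<exists>N. sets N = sets (borel :: 'o measure) \<and> M = completion N"
    and "atomless M"
    and "Lambda_C1 M (\<lambda>X. f (distr M borel X)) D"
  shows "\<forall>\<mu>\<in>P2. \<exists>G :: 'h \<Rightarrow> ('h \<Rightarrow>\<^sub>L 'u). G \<in> borel_measurable borel \<and>
    (\<forall>X\<in>L2 M. distr M borel X = \<mu> \<longrightarrow>
      ((\<lambda>\<omega>. G (X \<omega>)) \<in> borel_measurable M \<and> integrable M (\<lambda>\<omega>. (norm (G (X \<omega>)))\<^sup>2)) \<and>
      (\<forall>Y\<in>L2 M. integrable M (\<lambda>\<omega>. blinfun_apply (G (X \<omega>)) (Y \<omega>)) \<and>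
         D X Y = vm_integral M (D X) Y \<and>
         vm_integral M (D X) Y = vm_integral M (D X) (cond_exp_H M X Y) \<and>
         vm_integral M (D X) (cond_exp_H M X Y) = (\<integral>\<omega>. blinfun_apply (G (X \<omega>)) (Y \<omega>) \<partial>M)) \<and>
      ereal (sqrt (\<integral>\<omega>. (norm (G (X \<omega>)))\<^sup>2 \<partial>M)) = tnorm M (D X) \<and>
      (\<forall>B\<in>sets borel. \<forall>u. D X (\<lambda>\<omega>. indicator (X -` B \<inter> space M) \<omega> *\<^sub>R u)
          = (\<integral>x. indicator B x *\<^sub>R blinfun_apply (G x) u \<partial>\<mu>)) \<and>
      (\<forall>G' :: 'h \<Rightarrow> ('h \<Rightarrow>\<^sub>L 'u). G' \<in> borel_measurable borel \<and>
          integrable \<mu> (\<lambda>x. (norm (G' x))\<^sup>2) \<and>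
          (\<forall>B\<in>sets borel. \<forall>u. D X (\<lambda>\<omega>. indicator (X -` B \<inter> space M) \<omega> *\<^sub>R u)
              = (\<integral>x. indicator B x *\<^sub>R blinfun_apply (G' x) u \<partial>\<mu>))
          \<longrightarrow> (AE x in \<mu>. G' x = G x)))"
    (is "\<forall>\<mu>\<in>P2. ?P \<mu>")
proof
  fix \<mu> :: "'h measure" assume \<mu>: "\<mu> \<in> P2"
  interpret prob_space M by fact
  note C1 = assms(4)
  have fin: "finite_measure \<mu>" and sets_\<mu>: "sets \<mu> = sets borel"
    using \<mu> prob_space.finite_measure by (auto simp: P2_def)
  show "?P \<mu>"
  proof (cases "\<exists>X0\<in>L2 M. distr M borel X0 = \<mu>")
    case False
    \<comment> \<open>No X has law mu, so every requirement beyond measurability is vacuous.\<close>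
    then show ?thesis by (intro exI[of _ "\<lambda>_. 0"]) auto
  next
    case True
    then obtain X0 where X0: "X0 \<in> L2 M" "distr M borel X0 = \<mu>" by blast
    note X0m = L2D(1)[OF X0(1)]
    have sq: "integrable \<mu> (\<lambda>x. (norm (K x))\<^sup>2) \<longleftrightarrow> integrable M (\<lambda>\<omega>. (norm (K (X \<omega>)))\<^sup>2)"
      "(\<integral>x. (norm (K x))\<^sup>2 \<partial>\<mu>) = (\<integral>\<omega>. (norm (K (X \<omega>)))\<^sup>2 \<partial>M)"
      if "X \<in> L2 M" "distr M borel X = \<mu>" "K \<in> borel_measurable borel" for X and K :: "'h \<Rightarrow> 'h \<Rightarrow>\<^sub>L 'u"
    proof -
      have "(\<lambda>x. (norm (K x))\<^sup>2) \<in> borel_measurable borel"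
        by (rule measurable_compose[OF that(3)]) (intro borel_measurable_continuous_onI continuous_intros)
      then show "integrable \<mu> (\<lambda>x. (norm (K x))\<^sup>2) \<longleftrightarrow> integrable M (\<lambda>\<omega>. (norm (K (X \<omega>)))\<^sup>2)"
        "(\<integral>x. (norm (K x))\<^sup>2 \<partial>\<mu>) = (\<integral>\<omega>. (norm (K (X \<omega>)))\<^sup>2 \<partial>M)"
        unfolding that(2)[symmetric]
        using integrable_distr_eq[OF L2D(1)[OF that(1)]] integral_distr[OF L2D(1)[OF that(1)]] by auto
    qed
    \<comment> \<open>G comes from one fixed representative X0 and must then serve every X with the
      same law.\<close>
    from Lambda_C1_density[OF assms(3) C1 X0(1)] obtain G where
      G: "G \<in> borel_measurable borel" "operator_L2 M (\<lambda>\<omega>. G (X0 \<omega>))"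
        "\<And>Y. Y \<in> L2 M \<Longrightarrow> D X0 Y = (\<integral>\<omega>. G (X0 \<omega>) (Y \<omega>) \<partial>M)"
      by (elim exE conjE) blast
    have G_sq: "integrable \<mu> (\<lambda>x. (norm (G x))\<^sup>2)"
      using G(2) sq(1)[OF X0 G(1)] by (simp add: operator_L2_def)
    have G_dens: "D X (\<lambda>\<omega>. indicator (X -` B \<inter> space M) \<omega> *\<^sub>R u) = (\<integral>x. indicator B x *\<^sub>R G x u \<partial>\<mu>)"
      if "X \<in> L2 M" "distr M borel X = \<mu>" "B \<in> sets borel" for X B u
      using Lambda_C1_law_invariant[OF C1 that(1) X0(1) _ that(3), of u]
        derivative_measure_density[of X0 G "D X0" B u, OF X0m G(1) G(3) that(3)] that(2) X0(2) by simp
    show ?thesis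
    proof (intro exI[of _ G] conjI ballI impI)
      show "G \<in> borel_measurable borel" by (rule G)
      fix X assume X: "X \<in> L2 M" and law: "distr M borel X = \<mu>"
      note Xm = L2D(1)[OF X]
      have bl: "bounded_linear_L2 M (D X)" using C1 X by (simp add: Lambda_C1_def frechet_L2_def)
      note vm = vm_integral_eq[OF bl finite_measure_axioms]
      show GX: "(\<lambda>\<omega>. G (X \<omega>)) \<in> borel_measurable M" by (rule measurable_compose[OF Xm G(1)])
      show GX_sq: "integrable M (\<lambda>\<omega>. (norm (G (X \<omega>)))\<^sup>2)" using G_sq sq(1)[OF X law G(1)] by simp
      have opG: "operator_L2 M (\<lambda>\<omega>. G (X \<omega>))"
        using GX_sq borel_measurable_blinfun_apply_const[OF GX] by (simp add: operator_L2_def)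
      \<comment> \<open>X has its own density K, with the norm identity and the approximants. Both K
        and G are densities of the same vector measure with respect to mu, so they agree almost
        everywhere and the properties of K pass to G.\<close>
      from Lambda_C1_density[OF assms(3) C1 X] obtain K h where
        K: "K \<in> borel_measurable borel" "operator_L2 M (\<lambda>\<omega>. K (X \<omega>))"
          "\<forall>Y\<in>L2 M. D X Y = (\<integral>\<omega>. K (X \<omega>) (Y \<omega>) \<partial>M)"
          "tnorm M (D X) = ereal (L2norm M (\<lambda>\<omega>. K (X \<omega>)))"
        and h: "\<forall>j. simple_function borel (h j) \<and> operator_L2 M (\<lambda>\<omega>. K (X \<omega>) - h j (X \<omega>))"
          "(\<lambda>j. L2norm M (\<lambda>\<omega>. K (X \<omega>) - h j (X \<omega>))) \<longlonglongrightarrow> 0"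
        by (elim exE conjE)
      have K_sq: "integrable \<mu> (\<lambda>x. (norm (K x))\<^sup>2)"
        using K(2) sq(1)[OF X law K(1)] by (simp add: operator_L2_def)
      have "AE x in \<mu>. K x = G x"
      proof (rule operator_density_unique[OF fin sets_\<mu> K(1) K_sq G(1) G_sq])
        show "(\<integral>x. indicator B x *\<^sub>R K x u \<partial>\<mu>) = (\<integral>x. indicator B x *\<^sub>R G x u \<partial>\<mu>)" if "B \<in> sets borel" for B u
          using derivative_measure_density[of X K "D X" B u, OF Xm K(1) _ that] K(3) G_dens[OF X law that, of u] law by simp
      qed
      then have KG: "AE \<omega> in M. K (X \<omega>) = G (X \<omega>)"
        unfolding law[symmetric] by (rule AE_distrD[OF Xm])
      have int_eq: "(\<integral>\<omega>. K (X \<omega>) (Y \<omega>) \<partial>M) = (\<integral>\<omega>. G (X \<omega>) (Y \<omega>) \<partial>M)" if "Y \<in> L2 M" for Y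
        using KG operator_L2_integrable[OF K(2) that] operator_L2_integrable[OF opG that]
        by (intro integral_cong_AE) auto
      {
        fix Y :: "'o \<Rightarrow> 'h" assume Y: "Y \<in> L2 M"
        note Z = cond_exp_H_correct[OF Xm Y]
        show "integrable M (\<lambda>\<omega>. G (X \<omega>) (Y \<omega>))" by (rule operator_L2_integrable[OF opG Y])
        show "D X Y = vm_integral M (D X) Y" by (rule vm[OF Y, symmetric])
        \<comment> \<open>Shown with K, since the approximants h belong to K; \<open>int_eq\<close>
          then brings in G.\<close>
        have "D X (cond_exp_H M X Y) = D X Y"
          using K(3) Z(2) Y integral_operator_cond_exp_H[of X Y "cond_exp_H M X Y" K h, OF Xm Y Z(2,1) K(2) _ _ h(2)] h(1) by simp
        then show "vm_integral M (D X) Y = vm_integral M (D X) (cond_exp_H M X Y)"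
          "vm_integral M (D X) (cond_exp_H M X Y) = (\<integral>\<omega>. G (X \<omega>) (Y \<omega>) \<partial>M)"
          using K(3) Y int_eq[OF Y] by (auto simp: vm[OF Y] vm[OF Z(2)])
      }
      have "(\<integral>\<omega>. (norm (K (X \<omega>)))\<^sup>2 \<partial>M) = (\<integral>\<omega>. (norm (G (X \<omega>)))\<^sup>2 \<partial>M)"
        using KG GX_sq K(2) by (intro integral_cong_AE) (auto simp: operator_L2_def)
      then show "ereal (sqrt (\<integral>\<omega>. (norm (G (X \<omega>)))\<^sup>2 \<partial>M)) = tnorm M (D X)"
        by (simp add: K(4) L2norm_def)
      have dens: "D X (\<lambda>\<omega>. indicator (X -` B \<inter> space M) \<omega> *\<^sub>R u) = (\<integral>x. indicator B x *\<^sub>R G x u \<partial>\<mu>)"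
        if "B \<in> sets borel" for B u
        by (rule G_dens[OF X law that])
      then show "\<forall>u. D X (\<lambda>\<omega>. indicator (X -` B \<inter> space M) \<omega> *\<^sub>R u) = (\<integral>x. indicator B x *\<^sub>R G x u \<partial>\<mu>)"
        if "B \<in> sets borel" for B
        using that by blast
      show "\<forall>G' :: 'h \<Rightarrow> ('h \<Rightarrow>\<^sub>L 'u). G' \<in> borel_measurable borel \<and>
          integrable \<mu> (\<lambda>x. (norm (G' x))\<^sup>2) \<and>
          (\<forall>B\<in>sets borel. \<forall>u. D X (\<lambda>\<omega>. indicator (X -` B \<inter> space M) \<omega> *\<^sub>R u)
              = (\<integral>x. indicator B x *\<^sub>R blinfun_apply (G' x) u \<partial>\<mu>))
          \<longrightarrow> (AE x in \<mu>. G' x = G x)"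
      proof (intro allI impI, elim conjE)
        fix G' :: "'h \<Rightarrow> ('h \<Rightarrow>\<^sub>L 'u)"
        assume G': "G' \<in> borel_measurable borel" "integrable \<mu> (\<lambda>x. (norm (G' x))\<^sup>2)"
          "\<forall>B\<in>sets borel. \<forall>u. D X (\<lambda>\<omega>. indicator (X -` B \<inter> space M) \<omega> *\<^sub>R u)
              = (\<integral>x. indicator B x *\<^sub>R blinfun_apply (G' x) u \<partial>\<mu>)"
        show "AE x in \<mu>. G' x = G x"
          by (rule operator_density_unique[OF fin sets_\<mu> G'(1,2) G(1) G_sq]) (use G'(3) dens in simp)
      qed
    qed
  qed
qed

end
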